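(* Let $G$ be a $\mathcal{C}$-orderable group. If $G$ admits only finitely many $\mathcal{C}$-orderings, then $G$ admits a unique (hence normal) rational series, and in this series no quotient $G_{i+2}/G_i$ is Abelian. Conversely, if $G$ is a group admitting a normal rational series $\{id\}=G_0\lhd G_1\lhd\cdots\lhd G_{n-1}\lhd G_n=G$ such that no quotient $G_{i+2}/G_i$ is Abelian, then the number of $\mathcal{C}$-orderings on $G$ equals $2^n$.
   Context: A left-ordering on $G$ is a total order $\preceq$ invariant under left multiplication. A $\mathcal{C}$-ordering (Conradian ordering) is a left-ordering such that for all $f\succ id$, $g\succ id$ there is $n\in\mathbb{N}$ with $fg^n\succ g$; $G$ is $\mathcal{C}$-orderable if it admits one. A series $\{id\}=G_0\lhd G_1\lhd\cdots\lhd G_n=G$ is rational if each $G_i$ is normal in $G_{i+1}$ and each quotient $G_{i+1}/G_i$ is torsion-free rank-one Abelian; it is normal if moreover each $G_i$ is normal in $G$. *)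

theory Defs
  imports "HOL-Algebra.Algebra"
begin

definition left_ordering :: "('a, 'b) monoid_scheme \<Rightarrow> 'a rel \<Rightarrow> bool" where
  "left_ordering G R \<longleftrightarrow>
     R \<subseteq> carrier G \<times> carrier G \<and>
     (\<forall>x\<in>carrier G. (x, x) \<in> R) \<and>
     (\<forall>x\<in>carrier G. \<forall>y\<in>carrier G. (x, y) \<in> R \<and> (y, x) \<in> R \<longrightarrow> x = y) \<and>
     (\<forall>x\<in>carrier G. \<forall>y\<in>carrier G. \<forall>z\<in>carrier G.
        (x, y) \<in> R \<and> (y, z) \<in> R \<longrightarrow> (x, z) \<in> R) \<and>
     (\<forall>x\<in>carrier G. \<forall>y\<in>carrier G. (x, y) \<in> R \<or> (y, x) \<in> R) \<and>
     (\<forall>f\<in>carrier G. \<forall>x\<in>carrier G. \<forall>y\<in>carrier G.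
        (x, y) \<in> R \<longrightarrow> (f \<otimes>\<^bsub>G\<^esub> x, f \<otimes>\<^bsub>G\<^esub> y) \<in> R)"

definition strictly_less :: "'a rel \<Rightarrow> 'a \<Rightarrow> 'a \<Rightarrow> bool" where
  "strictly_less R x y \<longleftrightarrow> (x, y) \<in> R \<and> x \<noteq> y"

definition C_ordering :: "('a, 'b) monoid_scheme \<Rightarrow> 'a rel \<Rightarrow> bool" where
  "C_ordering G R \<longleftrightarrow> left_ordering G R \<and>
     (\<forall>f\<in>carrier G. \<forall>g\<in>carrier G.
        strictly_less R \<one>\<^bsub>G\<^esub> f \<and> strictly_less R \<one>\<^bsub>G\<^esub> g \<longrightarrow>
        (\<exists>n::nat. n \<ge> 1 \<and> strictly_less R g (f \<otimes>\<^bsub>G\<^esub> (g [^]\<^bsub>G\<^esub> n))))"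

definition C_orderable :: "('a, 'b) monoid_scheme \<Rightarrow> bool" where
  "C_orderable G \<longleftrightarrow> (\<exists>R. C_ordering G R)"

definition tf_rank_one :: "'c monoid \<Rightarrow> bool" where
  "tf_rank_one Q \<longleftrightarrow> comm_group Q \<and>
     carrier Q \<noteq> {\<one>\<^bsub>Q\<^esub>} \<and>
     (\<forall>x\<in>carrier Q. \<forall>k::int. k \<noteq> 0 \<and> x [^]\<^bsub>Q\<^esub> k = \<one>\<^bsub>Q\<^esub> \<longrightarrow> x = \<one>\<^bsub>Q\<^esub>) \<and>
     (\<forall>x\<in>carrier Q. \<forall>y\<in>carrier Q. \<exists>(a::int) (b::int). (a \<noteq> 0 \<or> b \<noteq> 0) \<and>
        x [^]\<^bsub>Q\<^esub> a \<otimes>\<^bsub>Q\<^esub> y [^]\<^bsub>Q\<^esub> b = \<one>\<^bsub>Q\<^esub>)"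

definition rational_series :: "('a, 'b) monoid_scheme \<Rightarrow> (nat \<Rightarrow> 'a set) \<Rightarrow> nat \<Rightarrow> bool" where
  "rational_series G S n \<longleftrightarrow>
     S 0 = {\<one>\<^bsub>G\<^esub>} \<and> S n = carrier G \<and>
     (\<forall>i\<le>n. subgroup (S i) G) \<and>
     (\<forall>i<n. normal (S i) (G\<lparr>carrier := S (Suc i)\<rparr>) \<and>
            tf_rank_one (G\<lparr>carrier := S (Suc i)\<rparr> Mod S i))"

definition normal_rational_series :: "('a, 'b) monoid_scheme \<Rightarrow> (nat \<Rightarrow> 'a set) \<Rightarrow> nat \<Rightarrow> bool" where
  "normal_rational_series G S n \<longleftrightarrow> rational_series G S n \<and> (\<forall>i\<le>n. normal (S i) G)"

definition no_abelian_two_step :: "('a, 'b) monoid_scheme \<Rightarrow> (nat \<Rightarrow> 'a set) \<Rightarrow> nat \<Rightarrow> bool" where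
  "no_abelian_two_step G S n \<longleftrightarrow>
     (\<forall>i. i + 2 \<le> n \<longrightarrow> \<not> comm_group (G\<lparr>carrier := S (i + 2)\<rparr> Mod S i))"

end

theory Submission
  imports Defs
begin

text \<open>An ordering is encoded by its positive cone, and a Conradian cone is studied through its convex
  subgroups, which form a chain. By Conrad's theorem and Hoelder's theorem each jump in this chain has
  an abelian quotient, whose ordering can be changed freely. Finitely many orderings therefore force
  finitely many jumps, each of rank one because an abelian group of larger rank has infinitely many
  orderings; the same remark applied to an abelian quotient of two consecutive jumps excludes it.

  Conversely, let \<open>S\<close> be a rational series without abelian two-step quotient. If \<open>S\<^sub>n\<^sub>-\<^sub>1\<close> were not convex for
  some Conradian cone, the convex closure of \<open>S\<^sub>n\<^sub>-\<^sub>1\<close> would be all of \<open>S\<^sub>n\<close>, and the abelian quotient of its jump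
  would make \<open>S\<^sub>n / S\<^sub>n\<^sub>-\<^sub>2\<close> abelian. So every Conradian cone has exactly the members of the series as
  convex subgroups; this gives uniqueness, and a cone amounts to one choice of sign per step.\<close>

subsection \<open>Positive cones and convex subgroups\<close>

text \<open>A left-ordering says nothing about multiplication on the right. What replaces
  right-invariance is that the exponent in the Conradian condition can always be taken to be 2: an
  inequality with a fixed exponent can be transported by left multiplication, and this makes
  conjugation respect the jumps. Cones live on subgroups \<open>H\<close> of one ambient group
  \<open>G\<close>, with products and inverses taken in \<open>G\<close>, so inductions run along a
  chain without changing the group. Normality in \<open>G\<close> is not visible from the
  construction, since conjugation may change the ordering whose convex subgroups form the chain. It
  comes from uniqueness: a conjugated rational series is again a rational series with the same top.
  It already enters the construction, because a two-step quotient is a group only if its lower term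
  is normal in the upper one. A competing series need not look convex for a given cone. For
  uniqueness, a cone is therefore built from the competing series itself, and the nonabelian series
  is convex for that cone as for any other.\<close>

definition pos_cone :: "('a, 'b) monoid_scheme \<Rightarrow> 'a set \<Rightarrow> 'a set \<Rightarrow> bool" where
  "pos_cone G H P \<longleftrightarrow> P \<subseteq> H \<and> \<one>\<^bsub>G\<^esub> \<notin> P \<and>
     (\<forall>x\<in>P. \<forall>y\<in>P. x \<otimes>\<^bsub>G\<^esub> y \<in> P) \<and>
     (\<forall>x\<in>H. x = \<one>\<^bsub>G\<^esub> \<or> x \<in> P \<or> inv\<^bsub>G\<^esub> x \<in> P)"

definition conrad_cone :: "('a, 'b) monoid_scheme \<Rightarrow> 'a set \<Rightarrow> 'a set \<Rightarrow> bool" where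
  "conrad_cone G H P \<longleftrightarrow> pos_cone G H P \<and>
     (\<forall>f\<in>P. \<forall>g\<in>P. \<exists>n::nat. inv\<^bsub>G\<^esub> g \<otimes>\<^bsub>G\<^esub> f \<otimes>\<^bsub>G\<^esub> g [^]\<^bsub>G\<^esub> n \<in> P)"

text \<open>Only elements between the identity and a member of \<open>K\<close> are tested. As
  \<open>K\<close> is a subgroup, left translation extends this to every interval with both ends in
  \<open>K\<close>.\<close>

definition convex_in :: "('a, 'b) monoid_scheme \<Rightarrow> 'a set \<Rightarrow> 'a set \<Rightarrow> 'a set \<Rightarrow> bool" where
  "convex_in G H P K \<longleftrightarrow> subgroup K G \<and> K \<subseteq> H \<and>
     (\<forall>g\<in>P. \<forall>c\<in>K. inv\<^bsub>G\<^esub> g \<otimes>\<^bsub>G\<^esub> c \<in> P \<longrightarrow> g \<in> K)"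

context group
begin

lemma mult_inv_cancel_left [simp]:
  assumes "x \<in> carrier G" "y \<in> carrier G"
  shows "x \<otimes> (inv x \<otimes> y) = y" "inv x \<otimes> (x \<otimes> y) = y"
  using assms by (simp_all flip: m_assoc)

end

locale cone_group = group G for G (structure) +
  fixes H P :: "'a set"
  assumes subgroup_H: "subgroup H G"
    and cone: "pos_cone G H P"
begin

definition lt :: "'a \<Rightarrow> 'a \<Rightarrow> bool" where "lt x y \<longleftrightarrow> inv x \<otimes> y \<in> P"

abbreviation convex :: "'a set \<Rightarrow> bool" where "convex \<equiv> convex_in G H P"

lemma H_carrier [simp, intro]: "x \<in> H \<Longrightarrow> x \<in> carrier G"
  using subgroup.mem_carrier[OF subgroup_H] .

lemma P_H: "x \<in> P \<Longrightarrow> x \<in> H"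
  using cone by (auto simp: pos_cone_def)

lemma P_carrier [simp, intro]: "x \<in> P \<Longrightarrow> x \<in> carrier G"
  using P_H by blast

lemma one_notin_P [simp]: "\<one> \<notin> P"
  using cone by (auto simp: pos_cone_def)

lemma P_mult [simp, intro]: "x \<in> P \<Longrightarrow> y \<in> P \<Longrightarrow> x \<otimes> y \<in> P"
  using cone by (auto simp: pos_cone_def)

lemma P_total: "x \<in> H \<Longrightarrow> x = \<one> \<or> x \<in> P \<or> inv x \<in> P"
  using cone by (auto simp: pos_cone_def)

lemma P_inv_notin: "x \<in> P \<Longrightarrow> inv x \<notin> P"
  using P_mult[of x "inv x"] by auto

lemma H_mult [simp, intro]: "x \<in> H \<Longrightarrow> y \<in> H \<Longrightarrow> x \<otimes> y \<in> H"
  using subgroup.m_closed[OF subgroup_H] .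

lemma H_inv [simp, intro]: "x \<in> H \<Longrightarrow> inv x \<in> H"
  using subgroup.m_inv_closed[OF subgroup_H] .

lemma H_one [simp]: "\<one> \<in> H"
  using subgroup.one_closed[OF subgroup_H] .

lemma H_pow [simp, intro]: "x \<in> H \<Longrightarrow> x [^] (n::nat) \<in> H"
  by (induction n) auto

lemma P_pow: "x \<in> P \<Longrightarrow> n > 0 \<Longrightarrow> x [^] (n::nat) \<in> P"
proof (induction n)
  case (Suc n) thus ?case by (cases "n = 0") auto
qed simp

lemma lt_trans: "\<lbrakk>lt x y; lt y z; x \<in> carrier G; y \<in> carrier G; z \<in> carrier G\<rbrakk> \<Longrightarrow> lt x z"
  unfolding lt_def by (drule (1) P_mult) (simp add: m_assoc)

lemma lt_mult [simp]:
  "\<lbrakk>x \<in> carrier G; y \<in> carrier G; z \<in> carrier G\<rbrakk> \<Longrightarrow> lt (z \<otimes> x) (z \<otimes> y) \<longleftrightarrow> lt x y"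
  unfolding lt_def by (simp add: m_assoc inv_mult_group)

lemma lt_one [simp]: "x \<in> carrier G \<Longrightarrow> lt \<one> x \<longleftrightarrow> x \<in> P"
  unfolding lt_def by simp

lemma lt_irrefl [simp]: "x \<in> carrier G \<Longrightarrow> \<not> lt x x"
  unfolding lt_def by simp

lemma lt_one_right: "x \<in> carrier G \<Longrightarrow> lt x \<one> \<longleftrightarrow> inv x \<in> P"
  unfolding lt_def by simp

lemma lt_mult_pos [simp]: "\<lbrakk>x \<in> carrier G; y \<in> P\<rbrakk> \<Longrightarrow> lt x (x \<otimes> y)"
  unfolding lt_def by simp

lemma lt_total: "\<lbrakk>x \<in> H; y \<in> H\<rbrakk> \<Longrightarrow> lt x y \<or> x = y \<or> lt y x"
proof -
  assume a: "x \<in> H" "y \<in> H"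
  hence *: "inv (inv x \<otimes> y) = inv y \<otimes> x" by (simp add: inv_mult_group)
  have "inv x \<otimes> y = \<one> \<Longrightarrow> x = y" using a by (metis H_carrier inv_closed inv_equality inv_inv)
  thus ?thesis using P_total[of "inv x \<otimes> y"] a * unfolding lt_def by auto
qed

lemma lt_asym: "\<lbrakk>lt x y; x \<in> carrier G; y \<in> carrier G\<rbrakk> \<Longrightarrow> \<not> lt y x"
  using lt_trans lt_irrefl by blast

lemma lt_P: "\<lbrakk>lt x y; x \<in> P; y \<in> carrier G\<rbrakk> \<Longrightarrow> y \<in> P"
  using lt_trans[of \<one> x y] by auto

lemma P_root:
  assumes "x \<in> H" "x [^] (n::nat) \<in> P"
  shows "x \<in> P"
proof (rule ccontr)
  assume "x \<notin> P"
  moreover have "x \<noteq> \<one>" using assms by auto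
  ultimately have "inv x \<in> P" using P_total assms by blast
  moreover have "n > 0" using assms(2) by (cases n) auto
  ultimately have "inv (x [^] n) \<in> P" using P_pow[of "inv x" n] nat_pow_inv assms by auto
  thus False using P_inv_notin assms(2) by blast
qed

lemma torsion_free: "\<lbrakk>x \<in> H; x [^] (n::nat) = \<one>; n > 0\<rbrakk> \<Longrightarrow> x = \<one>"
proof (rule ccontr)
  assume x: "x \<in> H" "x [^] n = \<one>" "n > 0" "x \<noteq> \<one>"
  then consider "x \<in> P" | "inv x \<in> P" using P_total by blast
  thus False
  proof cases
    case 2 thus ?thesis using P_pow[OF 2 x(3)] nat_pow_inv[of x n] x by simp
  qed (use P_pow[of x n] x in simp)
qed

text \<open>By left-invariance w^(n+1) g = w^n (w g) <= w^n g, so one inequality propagates to all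
  powers. This is the bound that gets contradicted in \<open>conrad_two\<close> and in
  \<open>conj_P\<close>.\<close>

lemma pow_mult_le:
  assumes "w \<in> carrier G" "g \<in> carrier G" and le: "w \<otimes> g = g \<or> lt (w \<otimes> g) g"
  shows "w [^] (n::nat) \<otimes> g = g \<or> lt (w [^] n \<otimes> g) g"
proof (induction n)
  case (Suc n)
  have eq: "w [^] Suc n \<otimes> g = w [^] n \<otimes> (w \<otimes> g)" using assms by (simp add: m_assoc)
  have "w [^] Suc n \<otimes> g = w [^] n \<otimes> g \<or> lt (w [^] Suc n \<otimes> g) (w [^] n \<otimes> g)"
    using assms unfolding eq by auto
  thus ?case using Suc lt_trans[of "w [^] Suc n \<otimes> g" "w [^] n \<otimes> g" g] assms by auto
qed (use assms in simp)

lemma lt_pow_mono: "\<lbrakk>g \<in> P; m < n\<rbrakk> \<Longrightarrow> lt (g [^] m) (g [^] (n::nat))"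
proof -
  assume "g \<in> P" "m < n"
  hence "g [^] n = g [^] m \<otimes> g [^] (n - m)" by (simp add: nat_pow_mult)
  thus ?thesis using \<open>g \<in> P\<close> \<open>m < n\<close> by (simp add: P_pow)
qed

lemma lt_pow_trans: "\<lbrakk>lt x (g [^] m); g \<in> P; x \<in> carrier G; m \<le> n\<rbrakk> \<Longrightarrow> lt x (g [^] (n::nat))"
  using lt_pow_mono[of g m n] lt_trans[of x "g [^] m" "g [^] n"] by (cases "m = n") auto

lemma convexD:
  assumes "convex K"
  shows "subgroup K G" "K \<subseteq> H" "\<And>g c. \<lbrakk>g \<in> P; c \<in> K; lt g c\<rbrakk> \<Longrightarrow> g \<in> K"
  using assms unfolding convex_in_def lt_def by auto

lemma convex_H: "convex H"
  unfolding convex_in_def using subgroup_H P_H by auto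

lemma convex_one: "convex {\<one>}"
  unfolding convex_in_def using P_inv_notin by (auto simp: triv_subgroup)

text \<open>A positive element lies between the identity and its n-th power, so convexity catches
  it; a negative one is replaced by its inverse.\<close>

lemma convex_isolated_nat:
  assumes K: "convex K" and x: "x \<in> H" "x [^] (n::nat) \<in> K" "n > 0"
  shows "x \<in> K"
proof -
  have pos: "y \<in> K" if y: "y \<in> P" "y [^] n \<in> K" for y
  proof (cases "n = 1")
    case True thus ?thesis using y by simp
  next
    case False
    with x(3) have "1 < n" by simp
    from lt_pow_mono[OF y(1) this] show ?thesis using convexD(3)[OF K y(1) y(2)] y(1) by simp
  qed
  show ?thesis
  proof -
    consider "x = \<one>" | "x \<in> P" | "inv x \<in> P" using P_total x(1) by blast
    thus ?thesis
    proof cases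
      case 1
      have "\<one> \<in> K" using subgroup.one_closed[OF convexD(1)[OF K]] .
      thus ?thesis by (simp only: 1)
    next
      case 2 thus ?thesis using pos x(2) by blast
    next
      case 3
      have "inv x [^] n \<in> K"
        using x(1) subgroup.m_inv_closed[OF convexD(1)[OF K] x(2)] nat_pow_inv[of x n] H_carrier by metis
      hence "inv x \<in> K" using pos 3 by blast
      thus ?thesis using subgroup.m_inv_closed[OF convexD(1)[OF K], of "inv x"] x(1) by simp
    qed
  qed
qed

lemma convex_isolated:
  assumes K: "convex K" and x: "x \<in> H" "x [^] (k::int) \<in> K" "k \<noteq> 0"
  shows "x \<in> K"
proof (cases "k > 0")
  case True
  then obtain n where "k = int n" "n > 0" using zero_less_imp_eq_int by blast
  thus ?thesis using convex_isolated_nat[OF K x(1), of n] x(2) by (simp add: int_pow_int)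
next
  case False
  define n where "n = nat (- k)"
  with False x(3) have n: "k = - int n" "n > 0" by auto
  have "inv (x [^] k) \<in> K" using subgroup.m_inv_closed[OF convexD(1)[OF K] x(2)] .
  hence "x [^] n \<in> K" using n x(1) by (simp add: int_pow_neg_int)
  thus ?thesis using convex_isolated_nat[OF K x(1)] n by blast
qed

text \<open>Outside a convex subgroup the sign depends only on the coset, left or right. If s p were
  negative, p < s^-1 would put p into \<open>K\<close>; if p s were negative, its inverse would be
  positive and below s^-1, hence in \<open>K\<close>.\<close>

lemma convex_absorb:
  assumes K: "convex K" and p: "p \<in> P" "p \<notin> K" and s: "s \<in> K"
  shows "s \<otimes> p \<in> P" "s \<otimes> p \<notin> K" "p \<otimes> s \<in> P" "p \<otimes> s \<notin> K"
proof -
  interpret K: subgroup K G using convexD(1)[OF K] .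
  have [simp]: "s \<in> H" "p \<in> H" using convexD(2)[OF K] s P_H p by auto
  have c [simp]: "s \<in> carrier G" "p \<in> carrier G" by auto
  show 1: "s \<otimes> p \<notin> K"
  proof
    assume "s \<otimes> p \<in> K"
    hence "inv s \<otimes> (s \<otimes> p) \<in> K" using s by blast
    thus False using p by simp
  qed
  show 2: "p \<otimes> s \<notin> K"
  proof
    assume "p \<otimes> s \<in> K"
    hence "p \<otimes> s \<otimes> inv s \<in> K" using s by blast
    thus False using p by (simp add: m_assoc)
  qed
  show "s \<otimes> p \<in> P"
  proof (rule ccontr)
    assume "s \<otimes> p \<notin> P"
    hence "inv (s \<otimes> p) \<in> P" using P_total[of "s \<otimes> p"] 1 K.one_closed by auto
    hence "lt p (inv s)" unfolding lt_def by (simp add: inv_mult_group)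
    thus False using convexD(3)[OF K, of p "inv s"] p s by auto
  qed
  show "p \<otimes> s \<in> P"
  proof (rule ccontr)
    assume "p \<otimes> s \<notin> P"
    hence a: "inv (p \<otimes> s) \<in> P" using P_total[of "p \<otimes> s"] 2 K.one_closed by auto
    have "lt (inv (p \<otimes> s)) (inv s)" using p(1) unfolding lt_def by (simp add: inv_mult_group m_assoc)
    hence "inv (p \<otimes> s) \<in> K" using convexD(3)[OF K a] s by blast
    thus False using 2 K.m_inv_closed by fastforce
  qed
qed

lemma subgroup_le_by_P:
  assumes "subgroup K G" "K \<subseteq> H" "subgroup L G" "K \<inter> P \<subseteq> L"
  shows "K \<subseteq> L"
proof
  interpret K: subgroup K G by fact
  interpret L: subgroup L G by fact
  fix x assume x: "x \<in> K"
  consider "x = \<one>" | "x \<in> P" | "inv x \<in> P" using P_total x assms(2) by blast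
  thus "x \<in> L"
    by cases (use assms(4) x L.m_inv_closed[of "inv x"] in auto)
qed

text \<open>A positive k in \<open>K\<close> outside \<open>L\<close> exceeds every positive l in
  \<open>L\<close>, since l >= k would put k into \<open>L\<close>. Then l lies in \<open>K\<close>
  by convexity, and a subgroup is controlled by its positive elements.\<close>

lemma convex_chain:
  assumes K: "convex K" and L: "convex L"
  shows "K \<subseteq> L \<or> L \<subseteq> K"
proof (rule ccontr)
  assume *: "\<not> ?thesis"
  then have "\<not> K \<inter> P \<subseteq> L"
    using subgroup_le_by_P convexD(1,2) K L by blast
  then obtain k where k: "k \<in> K" "k \<in> P" "k \<notin> L" by blast
  have "L \<inter> P \<subseteq> K"
  proof
    fix l assume l: "l \<in> L \<inter> P"
    have "lt k l \<or> k = l \<or> lt l k" using lt_total k l P_H by auto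
    thus "l \<in> K" using convexD(3)[OF L k(2), of l] convexD(3)[OF K, of l k] k l by auto
  qed
  thus False using * subgroup_le_by_P convexD(1,2) K L by blast
qed

text \<open>The lower half of the jump at a positive \<open>g\<close>: since convex subgroups form a
  chain, this union is itself a convex subgroup, the largest one missing \<open>g\<close>. The upper
  half is \<open>arch g\<close>.\<close>

definition low :: "'a \<Rightarrow> 'a set" where
  "low g = \<Union> {K. convex K \<and> g \<notin> K}"

lemma low_notin: "g \<notin> low g"
  unfolding low_def by blast

lemma low_greatest: "convex K \<Longrightarrow> g \<notin> K \<Longrightarrow> K \<subseteq> low g"
  unfolding low_def by blast

lemma convex_low:
  assumes "g \<in> P"
  shows "convex (low g)"
proof -
  have "g \<noteq> \<one>" using assms by auto
  hence one: "\<one> \<in> low g" using low_greatest[OF convex_one] by simp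
  have common: "\<exists>K. convex K \<and> g \<notin> K \<and> x \<in> K \<and> y \<in> K" if "x \<in> low g" "y \<in> low g" for x y
    using that convex_chain unfolding low_def by blast
  have "low g \<subseteq> H" unfolding low_def using convexD(2) by blast
  moreover have "subgroup (low g) G"
  proof
    show "low g \<subseteq> carrier G" using \<open>low g \<subseteq> H\<close> by blast
    show "\<one> \<in> low g" by fact
    show "x \<otimes> y \<in> low g" if xy: "x \<in> low g" "y \<in> low g" for x y
      using common[OF xy] low_greatest convexD(1) subgroup.m_closed by (metis subsetD)
    show "inv x \<in> low g" if x: "x \<in> low g" for x
      using common[OF x x] low_greatest convexD(1) subgroup.m_inv_closed by (metis subsetD)
  qed
  moreover have "h \<in> low g" if "h \<in> P" "c \<in> low g" "inv h \<otimes> c \<in> P" for h c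
    using common[OF that(2,2)] convexD(3) low_greatest that unfolding lt_def by (metis subsetD)
  ultimately show ?thesis unfolding convex_in_def by blast
qed

lemma restrict_cone:
  assumes "subgroup D G" "D \<subseteq> H"
  shows "cone_group G D (P \<inter> D)"
proof -
  interpret D: subgroup D G by fact
  show ?thesis
    by unfold_locales (use P_total assms P_mult in \<open>auto simp: pos_cone_def\<close>)
qed

lemma convex_trans:
  assumes "convex D" "convex_in G D (P \<inter> D) K"
  shows "convex K"
proof -
  interpret D: subgroup D G using convexD(1)[OF assms(1)] .
  have K: "subgroup K G" "K \<subseteq> D" using assms(2) unfolding convex_in_def by auto
  have "g \<in> K" if g: "g \<in> P" "c \<in> K" "inv g \<otimes> c \<in> P" for g c
  proof -
    have c: "c \<in> D" using g K by blast
    have "g \<in> D" using convexD(3)[OF assms(1), of g c] c g unfolding lt_def by blast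
    moreover from this c have "inv g \<otimes> c \<in> D" by blast
    ultimately show ?thesis using assms(2) g unfolding convex_in_def by blast
  qed
  thus ?thesis using K convexD(2)[OF assms(1)] unfolding convex_in_def by blast
qed

lemma convex_restrict:
  assumes "convex K" "subgroup D G" "D \<subseteq> H"
  shows "convex_in G D (P \<inter> D) (K \<inter> D)"
  unfolding convex_in_def
  using subgroups_Inter_pair[OF convexD(1)[OF assms(1)] assms(2)] convexD(3)[OF assms(1)]
  unfolding lt_def by blast

end

subsection \<open>Conrad's theorem\<close>

locale conrad_group = cone_group +
  assumes conrad: "\<And>f g. f \<in> P \<Longrightarrow> g \<in> P \<Longrightarrow> \<exists>n::nat. inv g \<otimes> f \<otimes> g [^] n \<in> P"
begin

lemma conrad_lt: "f \<in> P \<Longrightarrow> g \<in> P \<Longrightarrow> \<exists>n::nat. lt g (f \<otimes> g [^] n)"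
  using conrad[of f g] unfolding lt_def by (auto simp: m_assoc)

text \<open>Suppose w g <= g for w = f g; then w^n g <= g for all n. The Conradian condition for f
  and w, rather than f and g, gives f g = w < f w^n, hence g < w^n < w^n g, a contradiction.\<close>

lemma conrad_two:
  assumes f: "f \<in> P" and g: "g \<in> P"
  shows "lt g (f \<otimes> g \<otimes> g)"
proof (rule ccontr)
  assume *: "\<not> ?thesis"
  define w where "w = f \<otimes> g"
  have w: "w \<in> P" using f g by (simp add: w_def)
  have le: "w \<otimes> g = g \<or> lt (w \<otimes> g) g"
    using lt_total[of g "w \<otimes> g"] * f g P_H by (auto simp: w_def)
  have le_pow: "w [^] n \<otimes> g = g \<or> lt (w [^] n \<otimes> g) g" for n :: nat
    using pow_mult_le[OF _ _ le] w g by blast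
  obtain n :: nat where "lt w (f \<otimes> w [^] n)" using conrad_lt[OF f w] by blast
  hence "lt g (w [^] n)" using f g w by (subst (asm) (1) w_def) simp
  moreover have "lt (w [^] n) (w [^] n \<otimes> g)" using w g by simp
  ultimately have "lt g (w [^] n \<otimes> g)" using lt_trans w g by (meson P_carrier m_closed nat_pow_closed)
  thus False using le_pow[of n] lt_asym w g by fastforce
qed

text \<open>The bound is imposed on x and on its inverse because g^-n < x and x^-1 < g^n are
  different statements in an order that is only left-invariant. For positive \<open>g\<close> this
  is the smallest convex subgroup containing \<open>g\<close>.\<close>

definition arch :: "'a \<Rightarrow> 'a set" where
  "arch g = {x \<in> H. \<exists>n::nat. lt x (g [^] n) \<and> lt (inv x) (g [^] n)}"

text \<open>A substitute for right-invariance, which makes \<open>arch g\<close> closed under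
  products. With h = g^n, the Conradian condition for the positive elements x^-1 h and h gives h <
  x^-1 h h^m, and left multiplication by x yields x h < h^(m+1).\<close>

lemma lt_pow_mult:
  assumes g: "g \<in> P" and x: "x \<in> H" "lt x (g [^] (n::nat))"
  shows "\<exists>N::nat. lt (x \<otimes> g [^] n) (g [^] N)"
proof (cases "n = 0")
  case True thus ?thesis using x by (auto intro: exI[of _ 0])
next
  case False
  define h where "h = g [^] n"
  have h: "h \<in> P" using P_pow[OF g] False by (simp add: h_def)
  have "inv x \<otimes> h \<in> P" using x by (simp add: lt_def h_def)
  then obtain m :: nat where "lt h (inv x \<otimes> h \<otimes> h [^] m)" using conrad_lt h by blast
  hence "lt (x \<otimes> h) (x \<otimes> (inv x \<otimes> h \<otimes> h [^] m))" using x h by simp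
  hence "lt (x \<otimes> h) (h \<otimes> h [^] m)" using x h by (simp add: m_assoc)
  also have "h \<otimes> h [^] m = g [^] (n + n * m)" using g by (simp add: h_def nat_pow_mult nat_pow_pow)
  finally show ?thesis unfolding h_def by blast
qed

lemma arch_bound:
  assumes "g \<in> P" "x \<in> arch g" "y \<in> arch g"
  obtains n :: nat where "lt x (g [^] n)" "lt (inv x) (g [^] n)" "lt y (g [^] n)" "lt (inv y) (g [^] n)"
proof -
  obtain n where n: "lt x (g [^] (n::nat))" "lt (inv x) (g [^] n)" using assms unfolding arch_def by auto
  obtain m where m: "lt y (g [^] (m::nat))" "lt (inv y) (g [^] m)" using assms unfolding arch_def by auto
  have [simp]: "x \<in> H" "y \<in> H" using assms unfolding arch_def by auto
  show ?thesis
    by (rule that[of "max n m"]) (rule lt_pow_trans, use n m assms in auto)+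
qed

lemma arch_mult_bound:
  assumes g: "g \<in> P" and "x \<in> H" "y \<in> H" "lt x (g [^] (n::nat))" "lt y (g [^] n)"
  shows "\<exists>N::nat. lt (x \<otimes> y) (g [^] N)"
proof -
  obtain N :: nat where N: "lt (x \<otimes> g [^] n) (g [^] N)" using lt_pow_mult[OF g assms(2,4)] by blast
  have "lt (x \<otimes> y) (x \<otimes> g [^] n)" using assms by simp
  from lt_trans[OF this N] show ?thesis using assms by auto
qed

lemma arch_self: "g \<in> P \<Longrightarrow> g \<in> arch g"
proof -
  assume g: "g \<in> P"
  have "lt g (g [^] (2::nat))" using lt_pow_mono[OF g, of 1 2] g by simp
  moreover have "lt (inv g) (g [^] (2::nat))"
    using lt_trans[of "inv g" \<one> "g [^] (2::nat)"] P_pow[OF g, of 2] g by (simp add: lt_one_right)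
  ultimately show ?thesis using g P_H unfolding arch_def by auto
qed

lemma convex_arch:
  assumes g: "g \<in> P"
  shows "convex (arch g)"
proof -
  have H: "arch g \<subseteq> H" unfolding arch_def by auto
  have "subgroup (arch g) G"
  proof
    show "arch g \<subseteq> carrier G" using H by auto
    have "lt \<one> (g [^] (1::nat))" using g by simp
    thus "\<one> \<in> arch g" unfolding arch_def by (auto intro!: exI[of _ "1::nat"] simp: g)
    show "inv x \<in> arch g" if "x \<in> arch g" for x using that unfolding arch_def by auto
    show "x \<otimes> y \<in> arch g" if xy: "x \<in> arch g" "y \<in> arch g" for x y
    proof -
      have [simp]: "x \<in> H" "y \<in> H" using xy H by auto
      obtain n :: nat where n: "lt x (g [^] n)" "lt (inv x) (g [^] n)" "lt y (g [^] n)" "lt (inv y) (g [^] n)"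
        using arch_bound[OF g xy] .
      obtain N :: nat where N: "lt (x \<otimes> y) (g [^] N)" using arch_mult_bound[OF g _ _ n(1,3)] by auto
      obtain M :: nat where M: "lt (inv y \<otimes> inv x) (g [^] M)" using arch_mult_bound[OF g _ _ n(4,2)] by auto
      have "lt (x \<otimes> y) (g [^] max N M)" by (rule lt_pow_trans[OF N g]) auto
      moreover have "lt (inv (x \<otimes> y)) (g [^] max N M)"
        using M by (simp add: inv_mult_group) (rule lt_pow_trans[OF M g], auto)
      ultimately show ?thesis unfolding arch_def by auto
    qed
  qed
  moreover have "y \<in> arch g" if y: "y \<in> P" "c \<in> arch g" "lt y c" for y c
  proof -
    obtain n :: nat where n: "lt c (g [^] n)" using y unfolding arch_def by auto
    have "lt y (g [^] n)" using lt_trans[OF y(3) n] y H g by auto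
    moreover from lt_P[OF this y(1)] have "lt (inv y) (g [^] n)"
      using lt_trans[of "inv y" \<one> "g [^] n"] y g by (simp add: lt_one_right)
    ultimately show ?thesis using y P_H unfolding arch_def by auto
  qed
  ultimately show ?thesis using H unfolding convex_in_def lt_def by blast
qed

lemma arch_least:
  assumes K: "convex K" and g: "g \<in> K" "g \<in> P"
  shows "arch g \<subseteq> K"
proof (rule subgroup_le_by_P)
  interpret K: subgroup K G using convexD(1)[OF K] .
  have pow: "g [^] n \<in> K" for n :: nat by (induction n) (use g in auto)
  show "arch g \<inter> P \<subseteq> K"
    using convexD(3)[OF K _ pow] unfolding arch_def by blast
qed (use convexD(1,2) convex_arch[OF g(2)] K in auto)

lemma low_le_arch: "g \<in> P \<Longrightarrow> low g \<subseteq> arch g"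
  using convex_chain[OF convex_low convex_arch, of g g] arch_self[of g] low_notin[of g] by auto

text \<open>\<open>arch h\<close> cannot miss \<open>g\<close>, for it would then be contained in
  \<open>low g\<close> together with h. Hence \<open>arch g\<close> lies in \<open>arch h\<close>,
  whose elements are bounded by powers of h.\<close>

lemma arch_cofinal:
  assumes g: "g \<in> P" and h: "h \<in> P" "h \<in> arch g" "h \<notin> low g" and x: "x \<in> arch g"
  shows "\<exists>n::nat. lt x (h [^] n)"
proof -
  have "g \<in> arch h"
    using low_greatest[OF convex_arch[OF h(1)], of g] arch_self[OF h(1)] h(3) by blast
  hence "arch g \<subseteq> arch h" using arch_least[OF convex_arch[OF h(1)]] g by blast
  thus ?thesis using x unfolding arch_def by blast
qed

lemma conj_pow:
  assumes "x \<in> carrier G" "y \<in> carrier G"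
  shows "(inv x \<otimes> y \<otimes> x) [^] (n::nat) = inv x \<otimes> y [^] n \<otimes> x"
  by (induction n) (use assms in \<open>simp_all add: m_assoc\<close>)

text \<open>A positive conjugate outside \<open>low g\<close> would have a power beyond d^2;
  negative conjugates are treated by passing to c^-1. The two directions of conjugation need
  different arguments, since the order is only left-invariant.\<close>

lemma conj_low:
  assumes g: "g \<in> P" and d: "d \<in> P" "d \<in> arch g" "d \<notin> low g" and c: "c \<in> low g"
  shows "inv d \<otimes> c \<otimes> d \<in> low g" "d \<otimes> c \<otimes> inv d \<in> low g"
proof -
  have low: "convex (low g)" using convex_low g .
  interpret L: subgroup "low g" G using convexD(1)[OF low] .
  interpret A: subgroup "arch g" G using convexD(1)[OF convex_arch[OF g]] .
  have lowH: "low g \<subseteq> H" using convexD(2)[OF low] .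
  have dH: "d \<in> H" using d P_H by auto
  have dd: "d \<otimes> d \<in> arch g" using d by blast
  have *: "inv d \<otimes> c \<otimes> d \<notin> P \<or> inv d \<otimes> c \<otimes> d \<in> low g" if c: "c \<in> low g" for c
  proof (rule ccontr)
    assume "\<not> ?thesis"
    hence y: "inv d \<otimes> c \<otimes> d \<in> P" "inv d \<otimes> c \<otimes> d \<notin> low g" by auto
    have yA: "inv d \<otimes> c \<otimes> d \<in> arch g" using low_le_arch[OF g] c d by blast
    then obtain k where k: "lt (d \<otimes> d) ((inv d \<otimes> c \<otimes> d) [^] (k::nat))"
      using arch_cofinal[OF g y(1) yA y(2) dd] by auto
    have cC: "c \<in> carrier G" using L.mem_carrier[OF c] .
    have ck: "c [^] k \<in> low g" using c by (induction k) auto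
    hence ckC: "c [^] k \<in> carrier G" using L.mem_carrier by simp
    \<comment> \<open>Twisting d by c^-k keeps it positive, by absorption. Then d < f d^2, and
      multiplication by c^k turns this into c^k d < d^3: the k-th power of the conjugate stays below
      d^2.\<close>
    define f where "f = inv (c [^] k) \<otimes> d"
    have f: "f \<in> P" "f \<notin> low g" using convex_absorb(1,2)[OF low d(1,3), of "inv (c [^] k)"] ck
      by (auto simp: f_def)
    have "lt (c [^] k \<otimes> d) (c [^] k \<otimes> (f \<otimes> d \<otimes> d))" using conrad_two[OF f(1) d(1)] ckC f d by simp
    hence "lt (c [^] k \<otimes> d) (d \<otimes> (d \<otimes> d))" using ckC d by (simp add: f_def m_assoc)
    hence "lt (inv d \<otimes> (c [^] k \<otimes> d)) (d \<otimes> d)"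
      using ckC d lt_mult[of "c [^] k \<otimes> d" "d \<otimes> (d \<otimes> d)" "inv d"] by simp
    moreover have "(inv d \<otimes> c \<otimes> d) [^] k = inv d \<otimes> (c [^] k \<otimes> d)"
      using conj_pow[of d c k] cC d ckC by (simp add: m_assoc)
    ultimately show False using k lt_asym ckC d by auto
  qed
  have inv_conj: "inv (inv d \<otimes> c \<otimes> d) = inv d \<otimes> inv c \<otimes> d"
    using c d by (simp add: inv_mult_group m_assoc)
  show "inv d \<otimes> c \<otimes> d \<in> low g"
  proof -
    have cH: "inv d \<otimes> c \<otimes> d \<in> H" using c lowH dH by auto
    consider "inv d \<otimes> c \<otimes> d = \<one>" | "inv d \<otimes> c \<otimes> d \<in> P" | "inv d \<otimes> inv c \<otimes> d \<in> P"
      using P_total[OF cH] inv_conj by auto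
    thus ?thesis
    proof cases
      case 1 thus ?thesis by simp
    next
      case 2 thus ?thesis using *[OF c] by blast
    next
      case 3
      hence "inv (inv d \<otimes> c \<otimes> d) \<in> low g" using *[of "inv c"] c inv_conj by auto
      from L.m_inv_closed[OF this] show ?thesis using c d by simp
    qed
  qed
  have **: "d \<otimes> c \<otimes> inv d \<notin> P \<or> d \<otimes> c \<otimes> inv d \<in> low g" if c: "c \<in> low g" for c
  proof (rule ccontr)
    assume "\<not> ?thesis"
    define y where "y = d \<otimes> c \<otimes> inv d"
    with \<open>\<not> ?thesis\<close> have y: "y \<in> P" "y \<notin> low g" by auto
    have cC: "c \<in> carrier G" using L.mem_carrier[OF c] .
    have yA: "y \<in> arch g" using low_le_arch[OF g] c d unfolding y_def by blast
    then obtain k where k: "lt (d \<otimes> d) (y [^] (k::nat))"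
      using arch_cofinal[OF g y(1) yA y(2) dd] by auto
    \<comment> \<open>From y^k = d^2 p, conjugating back gives c^k = d p d, which exceeds d.
      Convexity would then put d itself into \<open>low g\<close>.\<close>
    define p where "p = inv (d \<otimes> d) \<otimes> y [^] k"
    have p: "p \<in> P" using k by (simp add: lt_def p_def)
    have "c = inv d \<otimes> y \<otimes> d" using cC d by (simp add: y_def m_assoc)
    hence "c [^] k = inv d \<otimes> y [^] k \<otimes> d" using conj_pow[of d y k] d y by simp
    also have "y [^] k = d \<otimes> (d \<otimes> p)" using d y by (simp add: p_def inv_mult_group m_assoc)
    finally have ck: "c [^] k = d \<otimes> (p \<otimes> d)" using d p by (simp add: m_assoc)
    have "c [^] k \<in> low g" using c by (induction k) auto
    moreover have "lt d (c [^] k)" unfolding ck using d p by simp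
    ultimately show False using convexD(3)[OF low d(1)] d by blast
  qed
  have inv_conj2: "inv (d \<otimes> c \<otimes> inv d) = d \<otimes> inv c \<otimes> inv d"
    using c d by (simp add: inv_mult_group m_assoc)
  show "d \<otimes> c \<otimes> inv d \<in> low g"
  proof -
    have cH: "d \<otimes> c \<otimes> inv d \<in> H" using c lowH dH by auto
    consider "d \<otimes> c \<otimes> inv d = \<one>" | "d \<otimes> c \<otimes> inv d \<in> P" | "d \<otimes> inv c \<otimes> inv d \<in> P"
      using P_total[OF cH] inv_conj2 by auto
    thus ?thesis
    proof cases
      case 1 thus ?thesis by simp
    next
      case 2 thus ?thesis using **[OF c] by blast
    next
      case 3
      hence "inv (d \<otimes> c \<otimes> inv d) \<in> low g" using **[of "inv c"] c inv_conj2 by auto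
      from L.m_inv_closed[OF this] show ?thesis using c d by simp
    qed
  qed
qed

lemma low_conj_closed:
  assumes g: "g \<in> P" and x: "x \<in> arch g" and c: "c \<in> low g"
  shows "x \<otimes> c \<otimes> inv x \<in> low g"
proof -
  interpret A: subgroup "arch g" G using convexD(1)[OF convex_arch[OF g]] .
  interpret L: subgroup "low g" G using convexD(1)[OF convex_low[OF g]] .
  have xH: "x \<in> H" using x unfolding arch_def by blast
  show ?thesis
  proof (cases "x \<in> low g")
    case True thus ?thesis using c by blast
  next
    case False
    hence "inv x \<notin> low g" using L.m_inv_closed[of "inv x"] xH by auto
    moreover have "x \<in> P \<or> inv x \<in> P" using P_total[OF xH] False by auto
    ultimately show ?thesis using conj_low[OF g _ _ _ c, of x] conj_low(1)[OF g _ _ _ c, of "inv x"] x False xH by auto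
  qed
qed

end

subsection \<open>Hoelder's theorem\<close>

locale archimedean_group = cone_group G "carrier G" P for G (structure) and P +
  assumes archimedean: "\<And>g x. g \<in> P \<Longrightarrow> x \<in> carrier G \<Longrightarrow> \<exists>n::nat. lt x (g [^] n)"
begin

text \<open>The Archimedean property forces invariance on both sides. A negative b^-1 a b would mean
  a b < b, hence a^n b <= b for every n, whereas some power satisfies b < a^n < a^n b.\<close>

lemma conj_P:
  assumes a: "a \<in> P" and b: "b \<in> P"
  shows "inv b \<otimes> a \<otimes> b \<in> P"
proof (rule ccontr)
  assume "inv b \<otimes> a \<otimes> b \<notin> P"
  moreover have "inv b \<otimes> a \<otimes> b \<noteq> \<one>"
  proof
    assume "inv b \<otimes> a \<otimes> b = \<one>"
    hence "b \<otimes> (inv b \<otimes> a \<otimes> b) \<otimes> inv b = \<one>" using b by simp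
    thus False using a b by (simp add: m_assoc)
  qed
  ultimately have "inv (inv b \<otimes> a \<otimes> b) \<in> P" using P_total[of "inv b \<otimes> a \<otimes> b"] a b by auto
  hence "lt (a \<otimes> b) b" using a b by (simp add: lt_def inv_mult_group m_assoc)
  hence *: "a [^] n \<otimes> b = b \<or> lt (a [^] n \<otimes> b) b" for n :: nat using pow_mult_le[of a b n] a b by auto
  obtain n :: nat where n: "lt b (a [^] n)" using archimedean[OF a, of b] b by auto
  have "lt b (a [^] n \<otimes> b)" using lt_trans[OF n, of "a [^] n \<otimes> b"] a b by simp
  thus False using *[of n] lt_asym[of b "a [^] n \<otimes> b"] a b by auto
qed

lemma conj_P_inv:
  assumes a: "a \<in> P" and b: "b \<in> P"
  shows "b \<otimes> a \<otimes> inv b \<in> P"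
proof (rule ccontr)
  assume "b \<otimes> a \<otimes> inv b \<notin> P"
  moreover have "b \<otimes> a \<otimes> inv b \<noteq> \<one>"
  proof
    assume "b \<otimes> a \<otimes> inv b = \<one>"
    hence "inv b \<otimes> (b \<otimes> a \<otimes> inv b) \<otimes> b = \<one>" using b by simp
    thus False using a b by (simp add: m_assoc)
  qed
  ultimately have "inv (b \<otimes> a \<otimes> inv b) \<in> P" using P_total[of "b \<otimes> a \<otimes> inv b"] a b by auto
  from conj_P[OF this b] have "inv a \<in> P" using a b by (simp add: inv_mult_group m_assoc)
  thus False using P_inv_notin a by blast
qed

lemma conj_P_carrier:
  assumes a: "a \<in> P" and b: "b \<in> carrier G"
  shows "inv b \<otimes> a \<otimes> b \<in> P"
proof -
  consider "b = \<one>" | "b \<in> P" | "inv b \<in> P" using P_total b by blast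
  thus ?thesis
    by cases (use conj_P[OF a, of b] conj_P_inv[OF a, of "inv b"] a b in auto)
qed

lemma lt_mult_right:
  assumes "lt x y" "x \<in> carrier G" "y \<in> carrier G" "z \<in> carrier G"
  shows "lt (x \<otimes> z) (y \<otimes> z)"
  using conj_P_carrier[of "inv x \<otimes> y" z] assms by (simp add: lt_def inv_mult_group m_assoc)

lemma lt_mult_both:
  assumes "lt x y" "lt u v" "x \<in> carrier G" "y \<in> carrier G" "u \<in> carrier G" "v \<in> carrier G"
  shows "lt (x \<otimes> u) (y \<otimes> v)"
  using lt_trans[OF lt_mult_right[of x y u], of "y \<otimes> v"] assms by simp

lemma archimedean_floor:
  assumes e: "e \<in> P" and a: "a \<in> P"
  obtains m :: nat where "\<not> lt a (e [^] m)" "lt a (e [^] Suc m)"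
proof -
  define n where "n = (LEAST n::nat. lt a (e [^] n))"
  have "\<exists>n::nat. lt a (e [^] n)" using archimedean[OF e, of a] a by auto
  hence n: "lt a (e [^] n)" unfolding n_def by (rule LeastI_ex)
  have "n \<noteq> 0"
  proof
    assume "n = 0"
    thus False using n a P_inv_notin[OF a] by (simp add: lt_one_right)
  qed
  then obtain m where m: "n = Suc m" using not0_implies_Suc by blast
  have "\<not> lt a (e [^] m)" using not_less_Least[of m "\<lambda>n. lt a (e [^] n)"] m unfolding n_def by simp
  thus ?thesis using that n m by blast
qed

text \<open>For e^m <= a < e^(m+1) the remainder e^-m a is below e, so it cannot be
  positive.\<close>

lemma least_positive_cyclic:
  assumes e: "e \<in> P" and least: "\<And>q. q \<in> P \<Longrightarrow> \<not> lt q e" and a: "a \<in> P"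
  shows "\<exists>m::nat. a = e [^] m"
proof -
  obtain m :: nat where m: "\<not> lt a (e [^] m)" "lt a (e [^] Suc m)" using archimedean_floor[OF e a] .
  have "\<not> lt (e [^] m) a"
  proof
    assume "lt (e [^] m) a"
    hence "inv (e [^] m) \<otimes> a \<in> P" by (simp add: lt_def)
    moreover have "lt (inv (e [^] m) \<otimes> a) e"
      using m(2) e a lt_mult[of a "e [^] Suc m" "inv (e [^] m)"] by simp
    ultimately show False using least by blast
  qed
  thus ?thesis using lt_total[of a "e [^] m"] m(1) a e by auto
qed

text \<open>One of q and q^-1 c has a square at most c: if c < q^2, then e = q^-1 c is below q, and
  e^2 < q e = c.\<close>

lemma dense_sqrt:
  assumes c: "c \<in> P" and q: "q \<in> P" "lt q c"
  obtains e where "e \<in> P" "\<not> lt c (e \<otimes> e)"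
proof (cases "lt c (q \<otimes> q)")
  case True
  define e where "e = inv q \<otimes> c"
  have e: "e \<in> P" using q by (simp add: e_def lt_def)
  have "lt e q" using True c q lt_mult[of c "q \<otimes> q" "inv q"] by (simp add: e_def)
  hence "lt (e \<otimes> e) (q \<otimes> e)" using lt_mult_right e q by simp
  moreover have "q \<otimes> e = c" using q c by (simp add: e_def)
  ultimately show ?thesis using that[OF e] lt_asym[of "e \<otimes> e" c] e c by auto
qed (use that q in blast)

text \<open>A positive commutator c is beaten by rounding errors. Choose e with e^2 <= c, and e^m <=
  a < e^(m+1), e^n <= b < e^(n+1). Then a b < e^(m+n) e^2 <= b a c = a b. Such an e may fail to
  exist when there is a least positive element, but then a and b are powers of that element.\<close>

lemma commute_P:
  assumes a: "a \<in> P" and b: "b \<in> P"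
  shows "\<not> lt (b \<otimes> a) (a \<otimes> b)"
proof
  assume lt: "lt (b \<otimes> a) (a \<otimes> b)"
  define c where "c = inv (b \<otimes> a) \<otimes> (a \<otimes> b)"
  have c: "c \<in> P" using lt by (simp add: lt_def c_def)
  show False
  proof (cases "\<exists>e\<in>P. \<forall>q\<in>P. \<not> lt q e")
    case True
    then obtain e where e: "e \<in> P" "\<And>q. q \<in> P \<Longrightarrow> \<not> lt q e" by blast
    obtain m n :: nat where "a = e [^] m" "b = e [^] n"
      using least_positive_cyclic[OF e a] least_positive_cyclic[OF e b] by blast
    hence "a \<otimes> b = b \<otimes> a" using e by (simp add: nat_pow_mult add.commute)
    thus False using lt a b by simp
  next
    case False
    then obtain q where "q \<in> P" "lt q c" using c by blast
    then obtain e where e: "e \<in> P" "\<not> lt c (e \<otimes> e)" using dense_sqrt[OF c] by blast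
    obtain m :: nat where m: "\<not> lt a (e [^] m)" "lt a (e [^] Suc m)" using archimedean_floor[OF e(1) a] .
    obtain n :: nat where n: "\<not> lt b (e [^] n)" "lt b (e [^] Suc n)" using archimedean_floor[OF e(1) b] .
    have [simp]: "a \<in> carrier G" "b \<in> carrier G" "c \<in> carrier G" "e \<in> carrier G" using a b c e by auto
    have "lt (a \<otimes> b) (e [^] Suc m \<otimes> e [^] Suc n)" using lt_mult_both m n by simp
    also have "e [^] Suc m \<otimes> e [^] Suc n = e [^] (n + m) \<otimes> (e \<otimes> e)"
    proof -
      have "e \<otimes> e = e [^] (2::nat)" by (simp add: numeral_2_eq_2)
      thus ?thesis using nat_pow_mult[of e "Suc m" "Suc n"] nat_pow_mult[of e "n + m" 2]
        by (simp add: add.commute del: nat_pow_Suc)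
    qed
    finally have 1: "lt (a \<otimes> b) (e [^] (n + m) \<otimes> (e \<otimes> e))" .
    have am: "a = e [^] m \<or> lt (e [^] m) a" using lt_total[of a "e [^] m"] m by auto
    have bn: "b = e [^] n \<or> lt (e [^] n) b" using lt_total[of b "e [^] n"] n by auto
    have 2: "b \<otimes> a = e [^] (n + m) \<or> lt (e [^] (n + m)) (b \<otimes> a)"
    proof -
      have "b \<otimes> a = e [^] n \<otimes> e [^] m \<or> lt (e [^] n \<otimes> e [^] m) (b \<otimes> a)"
        using am bn lt_mult_both[of "e [^] n" b "e [^] m" a] lt_mult_right[of "e [^] n" b a] by auto
      thus ?thesis by (simp add: nat_pow_mult)
    qed
    have ee: "e \<otimes> e = c \<or> lt (e \<otimes> e) c" using e(2) lt_total[of "e \<otimes> e" c] by auto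
    have "e [^] (n + m) \<otimes> (e \<otimes> e) = b \<otimes> a \<otimes> c \<or> lt (e [^] (n + m) \<otimes> (e \<otimes> e)) (b \<otimes> a \<otimes> c)"
      using 2 ee lt_mult_both[of "e [^] (n + m)" "b \<otimes> a" "e \<otimes> e" c]
        lt_mult_right[of "e [^] (n + m)" "b \<otimes> a" c] by auto
    moreover have "b \<otimes> a \<otimes> c = a \<otimes> b"
      using mult_inv_cancel_left(1)[of "b \<otimes> a" "a \<otimes> b"] by (simp add: c_def)
    ultimately show False
      using 1 lt_asym[of "a \<otimes> b" "e [^] (n + m) \<otimes> (e \<otimes> e)"] by auto
  qed
qed

theorem hoelder: "comm_group G"
proof (rule group_comm_groupI)
  have PP: "a \<otimes> b = b \<otimes> a" if "a \<in> P" "b \<in> P" for a b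
    using commute_P[OF that] commute_P[OF that(2,1)] lt_total[of "b \<otimes> a" "a \<otimes> b"] that by auto
  have inv: "a \<otimes> b = b \<otimes> a" if "a \<otimes> inv b = inv b \<otimes> a" "a \<in> carrier G" "b \<in> carrier G" for a b
  proof -
    have "b \<otimes> (a \<otimes> inv b) \<otimes> b = b \<otimes> (inv b \<otimes> a) \<otimes> b" using that by simp
    thus ?thesis using that(2,3) by (simp add: m_assoc)
  qed
  have P1: "a \<otimes> b = b \<otimes> a" if ab: "a \<in> P" "b \<in> carrier G" for a b
  proof -
    consider "b = \<one>" | "b \<in> P" | "inv b \<in> P" using P_total ab(2) by blast
    thus ?thesis
    proof cases
      case 1 thus ?thesis using that by simp
    next
      case 2 thus ?thesis using PP that by blast
    next
      case 3 thus ?thesis using inv[OF PP[OF that(1) 3]] that by blast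
    qed
  qed
  show "x \<otimes> y = y \<otimes> x" if xy: "x \<in> carrier G" "y \<in> carrier G" for x y
  proof -
    consider "x = \<one>" | "x \<in> P" | "inv x \<in> P" using P_total xy(1) by blast
    thus ?thesis
    proof cases
      case 1 thus ?thesis using that by simp
    next
      case 2 thus ?thesis using P1 that by blast
    next
      case 3 thus ?thesis using inv[OF P1[OF 3 that(2), symmetric]] that by simp
    qed
  qed
qed

end

subsection \<open>Orderings of torsion-free abelian groups\<close>

context comm_group
begin

text \<open>By maximality, adjoining w must produce the identity as m w^n. Torsion-freeness excludes
  m = 1 with n > 0, so m is a member of \<open>M\<close> and equals w^-n.\<close>

lemma extend_semigroup_step:
  assumes max: "\<And>T. \<lbrakk>M \<subseteq> T; T \<subseteq> carrier G; \<one> \<notin> T; \<And>x y. x \<in> T \<Longrightarrow> y \<in> T \<Longrightarrow> x \<otimes> y \<in> T\<rbrakk> \<Longrightarrow> T = M"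
    and M: "M \<subseteq> carrier G" "\<one> \<notin> M" "\<And>x y. x \<in> M \<Longrightarrow> y \<in> M \<Longrightarrow> x \<otimes> y \<in> M"
    and tf: "\<And>n::nat. w [^] n = \<one> \<Longrightarrow> n = 0"
    and w: "w \<in> carrier G" "w \<notin> M"
  shows "\<exists>n::nat. n > 0 \<and> inv (w [^] n) \<in> M"
proof -
  define T where "T = {m \<otimes> w [^] n | m (n::nat). m \<in> M \<or> (m = \<one> \<and> n > 0)}"
  have "w = \<one> \<otimes> w [^] (1::nat)" using w by simp
  hence "w \<in> T" unfolding T_def by blast
  moreover have "M \<subseteq> T"
  proof
    fix m assume "m \<in> M"
    hence "m = m \<otimes> w [^] (0::nat)" using M(1) by auto
    thus "m \<in> T" unfolding T_def using \<open>m \<in> M\<close> by blast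
  qed
  moreover have "T \<subseteq> carrier G" unfolding T_def using M(1) w by auto
  moreover have "x \<otimes> y \<in> T" if xy: "x \<in> T" "y \<in> T" for x y
  proof -
    obtain m n where 1: "x = m \<otimes> w [^] (n::nat)" "m \<in> M \<or> (m = \<one> \<and> n > 0)" using xy unfolding T_def by blast
    obtain m' n' where 2: "y = m' \<otimes> w [^] (n'::nat)" "m' \<in> M \<or> (m' = \<one> \<and> n' > 0)" using xy unfolding T_def by blast
    have c: "m \<in> carrier G" "m' \<in> carrier G" using 1 2 M(1) by auto
    have "x \<otimes> y = (m \<otimes> m') \<otimes> w [^] (n + n')"
      using 1(1) 2(1) c w by (simp add: m_ac flip: nat_pow_mult)
    moreover have "m \<otimes> m' \<in> M \<or> (m \<otimes> m' = \<one> \<and> n + n' > 0)" using 1(2) 2(2) M c by auto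
    ultimately show ?thesis unfolding T_def by blast
  qed
  ultimately have "\<one> \<in> T" using max[of T] w(2) by blast
  then obtain m n where mn: "\<one> = m \<otimes> w [^] (n::nat)" "m \<in> M \<or> (m = \<one> \<and> n > 0)" unfolding T_def by blast
  have c: "m \<in> carrier G" using mn(2) M(1) by auto
  have "m \<in> M" using mn tf[of n] w by auto
  moreover have "n > 0" using mn(1) c \<open>m \<in> M\<close> M(2) by (cases n) auto
  moreover have "m = inv (w [^] n)" using inv_equality[of m "w [^] n"] mn(1) c w by simp
  ultimately show ?thesis by blast
qed

lemma pow_in_semigroup:
  assumes "\<And>x y. x \<in> M \<Longrightarrow> y \<in> M \<Longrightarrow> x \<otimes> y \<in> M" "x \<in> M" "x \<in> carrier G" "n > 0"
  shows "x [^] (n::nat) \<in> M"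
  using assms(4)
proof (induction n)
  case (Suc n) thus ?case by (cases "n = 0") (use assms in auto)
qed simp

text \<open>A relative form of Levi's theorem: a maximal semigroup without the identity is a cone.
  If it missed both z and z^-1, then some z^-n and some z^k would belong to it, hence also z^(nk)
  and its inverse.\<close>

lemma extend_semigroup_to_cone:
  assumes tf: "\<And>x n. \<lbrakk>x \<in> carrier G; x [^] (n::nat) = \<one>; n > 0\<rbrakk> \<Longrightarrow> x = \<one>"
    and S: "S \<subseteq> carrier G" "\<one> \<notin> S" "\<And>x y. x \<in> S \<Longrightarrow> y \<in> S \<Longrightarrow> x \<otimes> y \<in> S"
  obtains P where "S \<subseteq> P" "pos_cone G (carrier G) P"
proof -
  define \<T> where "\<T> = {T. S \<subseteq> T \<and> T \<subseteq> carrier G \<and> \<one> \<notin> T \<and> (\<forall>x\<in>T. \<forall>y\<in>T. x \<otimes> y \<in> T)}"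
  have "S \<in> \<T>" using S unfolding \<T>_def by blast
  have "\<exists>M\<in>\<T>. \<forall>U\<in>\<T>. M \<subseteq> U \<longrightarrow> U = M"
  proof (rule subset_Zorn_nonempty)
    show "\<T> \<noteq> {}" using \<open>S \<in> \<T>\<close> by blast
    fix \<C> assume C: "\<C> \<noteq> {}" "subset.chain \<T> \<C>"
    hence sub: "\<And>T. T \<in> \<C> \<Longrightarrow> T \<in> \<T>" and ch: "\<And>T U. T \<in> \<C> \<Longrightarrow> U \<in> \<C> \<Longrightarrow> T \<subseteq> U \<or> U \<subseteq> T"
      unfolding subset_chain_def by blast+
    have "x \<otimes> y \<in> \<Union> \<C>" if xy: "x \<in> \<Union> \<C>" "y \<in> \<Union> \<C>" for x y
    proof -
      obtain T where "T \<in> \<C>" "x \<in> T" "y \<in> T" using xy ch by blast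
      thus ?thesis using sub unfolding \<T>_def by blast
    qed
    thus "\<Union> \<C> \<in> \<T>" using C(1) sub unfolding \<T>_def by blast
  qed
  then obtain M where M: "M \<in> \<T>" "\<And>U. U \<in> \<T> \<Longrightarrow> M \<subseteq> U \<Longrightarrow> U = M" by blast
  have MS: "S \<subseteq> M" "M \<subseteq> carrier G" "\<one> \<notin> M" "\<And>x y. x \<in> M \<Longrightarrow> y \<in> M \<Longrightarrow> x \<otimes> y \<in> M"
    using M(1) unfolding \<T>_def by auto
  have max: "T = M" if T: "M \<subseteq> T" "T \<subseteq> carrier G" "\<one> \<notin> T" "\<And>x y. x \<in> T \<Longrightarrow> y \<in> T \<Longrightarrow> x \<otimes> y \<in> T" for T
  proof -
    have "T \<in> \<T>" unfolding \<T>_def using T(2-4) subset_trans[OF MS(1) T(1)] by simp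
    thus ?thesis using M(2) T(1) by simp
  qed
  have "z = \<one> \<or> z \<in> M \<or> inv z \<in> M" if z: "z \<in> carrier G" for z
  proof (rule ccontr)
    assume *: "\<not> ?thesis"
    have neg: "\<exists>n::nat. n > 0 \<and> inv (w [^] n) \<in> M" if w: "w \<in> carrier G" "w \<notin> M" "w \<noteq> \<one>" for w
      using extend_semigroup_step[OF max MS(2-4) _ w(1,2)] tf[OF w(1)] w(3) by blast
    obtain n where n: "n > 0" "inv (z [^] (n::nat)) \<in> M" using neg[of z] * z by blast
    obtain k where k: "k > 0" "inv (inv z [^] (k::nat)) \<in> M" using neg[of "inv z"] * z by auto
    have "z [^] k \<in> M" using k(2) nat_pow_inv[of z k] z by simp
    hence "(z [^] k) [^] n \<in> M" using pow_in_semigroup[OF MS(4)] n z by simp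
    moreover have "inv (z [^] n) [^] k \<in> M" using pow_in_semigroup[OF MS(4) n(2)] k z by simp
    moreover have "inv (z [^] n) [^] k = inv ((z [^] k) [^] n)"
      using nat_pow_inv[of "z [^] n" k] z by (simp add: nat_pow_pow mult.commute)
    ultimately have "(z [^] k) [^] n \<otimes> inv ((z [^] k) [^] n) \<in> M" using MS(4) by metis
    thus False using MS(3) z by simp
  qed
  thus ?thesis using that[of M] MS unfolding pos_cone_def by blast
qed

lemma cone_reverse:
  assumes "pos_cone G (carrier G) P"
  shows "pos_cone G (carrier G) {x \<in> carrier G. inv x \<in> P}"
  using assms unfolding pos_cone_def by (auto simp: inv_mult_group m_comm)

text \<open>Rank one gives z^a = u^-b. Both elements are positive for \<open>P\<close>, so a and b
  have opposite signs; thus a positive power of z is a positive power of u, and this fixes the sign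
  of z in \<open>Q\<close>.\<close>

lemma rank_one_cone_le:
  assumes "\<And>x y. x \<in> carrier G \<Longrightarrow> y \<in> carrier G \<Longrightarrow>
      \<exists>(a::int) (b::int). (a \<noteq> 0 \<or> b \<noteq> 0) \<and> x [^] a \<otimes> y [^] b = \<one>"
    and P: "pos_cone G (carrier G) P" and Q: "pos_cone G (carrier G) Q"
    and u: "u \<in> P" "u \<in> Q"
  shows "P \<subseteq> Q"
proof
  interpret P: cone_group G "carrier G" P by unfold_locales (use P subgroup_self in auto)
  interpret Q: cone_group G "carrier G" Q by unfold_locales (use Q subgroup_self in auto)
  fix z assume z: "z \<in> P"
  obtain a b :: int where ab: "a \<noteq> 0 \<or> b \<noteq> 0" "z [^] a \<otimes> u [^] b = \<one>" using assms(1)[of z u] z u by blast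
  have [simp]: "z \<in> carrier G" "u \<in> carrier G" using z u by auto
  have neg: "z [^] (- a) \<otimes> u [^] (- b) = \<one>"
    using arg_cong[OF ab(2), of "\<lambda>x. inv x"] by (simp add: int_pow_neg inv_mult_group m_comm)
  have pos_eq: "z \<in> Q" if "z [^] int m = u [^] int n" "n > 0" for m n
    using that Q.P_root[of z m] Q.P_pow[OF u(2), of n] by (simp add: int_pow_int)
  have eq: "z [^] a = u [^] (- b)"
    using ab(2) inv_equality[of "z [^] a" "u [^] b"] by (simp add: int_pow_neg)
  have sgn: "\<not> (c \<ge> 0 \<and> d \<ge> 0 \<and> (c \<noteq> 0 \<or> d \<noteq> 0) \<and> z [^] c \<otimes> u [^] d = \<one>)" for c d :: int
  proof
    assume *: "c \<ge> 0 \<and> d \<ge> 0 \<and> (c \<noteq> 0 \<or> d \<noteq> 0) \<and> z [^] c \<otimes> u [^] d = \<one>"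
    then obtain m n where mn: "c = int m" "d = int n" using zero_le_imp_eq_int by blast
    hence "m > 0 \<or> n > 0" using * by auto
    hence "z [^] m \<otimes> u [^] n \<in> P"
      using P.P_pow[OF z, of m] P.P_pow[OF u(1), of n] by (cases "m = 0"; cases "n = 0") auto
    thus False using * mn by (simp add: int_pow_int)
  qed
  have "a > 0 \<and> b < 0 \<or> a < 0 \<and> b > 0"
    using sgn[of a b] sgn[of "-a" "-b"] ab neg by linarith
  thus "z \<in> Q"
  proof
    assume "a > 0 \<and> b < 0"
    thus ?thesis using pos_eq[of "nat a" "nat (- b)"] eq by simp
  next
    assume *: "a < 0 \<and> b > 0"
    have "z [^] (- a) = u [^] b" using eq by (simp add: int_pow_neg)
    thus ?thesis using * pos_eq[of "nat (- a)" "nat b"] by simp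
  qed
qed

text \<open>The sign of a single nontrivial u determines the cone, so a cone and its reverse are the
  only ones. Existence is the extension lemma applied to the empty semigroup.\<close>

lemma rank_one_card_cones:
  assumes tf: "\<And>x n. \<lbrakk>x \<in> carrier G; x [^] (n::nat) = \<one>; n > 0\<rbrakk> \<Longrightarrow> x = \<one>"
    and rk: "\<And>x y. x \<in> carrier G \<Longrightarrow> y \<in> carrier G \<Longrightarrow>
      \<exists>(a::int) (b::int). (a \<noteq> 0 \<or> b \<noteq> 0) \<and> x [^] a \<otimes> y [^] b = \<one>"
    and nt: "carrier G \<noteq> {\<one>}"
  shows "card {P. pos_cone G (carrier G) P} = 2"
proof -
  obtain u where u: "u \<in> carrier G" "u \<noteq> \<one>" using nt by blast
  obtain P where P: "pos_cone G (carrier G) P"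
    by (rule extend_semigroup_to_cone[where S = "{}"]) (use tf in blast)+
  define P' where "P' = {x \<in> carrier G. inv x \<in> P}"
  have P': "pos_cone G (carrier G) P'" unfolding P'_def using cone_reverse[OF P] .
  have le: "A = B" if "pos_cone G (carrier G) A" "pos_cone G (carrier G) B" "v \<in> A" "v \<in> B" for A B v
    using rank_one_cone_le[OF rk] that by (meson subset_antisym)
  have "Q = P \<or> Q = P'" if Q: "pos_cone G (carrier G) Q" for Q
  proof -
    have "u \<in> P \<or> inv u \<in> P" "u \<in> Q \<or> inv u \<in> Q" using u P Q unfolding pos_cone_def by blast+
    moreover have "u \<in> P \<Longrightarrow> inv u \<in> P'" "inv u \<in> P \<Longrightarrow> u \<in> P'" unfolding P'_def using u by auto
    ultimately show ?thesis using le[OF Q P] le[OF Q P'] by blast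
  qed
  hence "{P. pos_cone G (carrier G) P} = {P, P'}" using P P' by blast
  moreover have "P \<noteq> P'"
  proof
    assume "P = P'"
    then obtain v where "v \<in> P" "inv v \<in> P" "v \<in> carrier G"
      using u P unfolding pos_cone_def P'_def by blast
    hence "v \<otimes> inv v \<in> P" using P unfolding pos_cone_def by blast
    thus False using P \<open>v \<in> carrier G\<close> unfolding pos_cone_def by simp
  qed
  ultimately show ?thesis by simp
qed

text \<open>Exponent arithmetic for two elements that bound x by powers of y from below and from
  above. It shows both that such bounds are compatible for adjacent slopes and that they clash for
  slopes in the wrong order.\<close>

lemma slope_product:
  fixes i j k l :: int
  assumes [simp]: "x \<in> carrier G" "y \<in> carrier G"
  shows "(x \<otimes> y [^] (- k)) [^] i \<otimes> (inv x \<otimes> y [^] l) [^] j = x [^] (i - j) \<otimes> y [^] (l * j - k * i)"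
proof -
  have "(x \<otimes> y [^] (- k)) [^] i \<otimes> (inv x \<otimes> y [^] l) [^] j
      = (x [^] i \<otimes> y [^] (- k * i)) \<otimes> (inv x [^] j \<otimes> y [^] (l * j))"
    using int_pow_distrib[of x "y [^] (- k)" i] int_pow_distrib[of "inv x" "y [^] l" j]
      int_pow_pow[of y "- k" i] int_pow_pow[of y l j] by simp
  also have "inv x [^] j = x [^] (- j)" using int_pow_inv[of x j] int_pow_neg[of x j] by simp
  also have "(x [^] i \<otimes> y [^] (- k * i)) \<otimes> (x [^] (- j) \<otimes> y [^] (l * j))
      = (x [^] i \<otimes> x [^] (- j)) \<otimes> (y [^] (l * j) \<otimes> y [^] (- k * i))"
    by (simp only: m_ac assms int_pow_closed m_closed)
  also have "\<dots> = x [^] (i + - j) \<otimes> y [^] (l * j + - k * i)"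
    using int_pow_mult[of x i "- j"] int_pow_mult[of y "l * j" "- k * i"] by simp
  finally show ?thesis by simp
qed

text \<open>The witnesses are orderings with \<open>y\<^sup>k \<prec> x \<prec> y\<^sup>k\<^sup>+\<^sup>1\<close>, one for each natural number \<open>k\<close>.\<close>

lemma independent_infinite_cones:
  assumes tf: "\<And>x n. \<lbrakk>x \<in> carrier G; x [^] (n::nat) = \<one>; n > 0\<rbrakk> \<Longrightarrow> x = \<one>"
    and xy [simp]: "x \<in> carrier G" "y \<in> carrier G"
    and indep: "\<And>(a::int) (b::int). x [^] a \<otimes> y [^] b = \<one> \<Longrightarrow> a = 0 \<and> b = 0"
  shows "infinite {P. pos_cone G (carrier G) P}"
proof -
  define u v where "u = (\<lambda>k::nat. x \<otimes> y [^] (- int k))" and "v = (\<lambda>k::nat. inv x \<otimes> y [^] (int k + 1))"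
  have uv [simp]: "u k \<in> carrier G" "v k \<in> carrier G" for k by (auto simp: u_def v_def)
  have "\<exists>P. pos_cone G (carrier G) P \<and> u k \<in> P \<and> v k \<in> P" for k
  proof -
    \<comment> \<open>The semigroup generated by the two elements that are to become positive; i + j
      > 0 excludes the empty product.\<close>
    define S where "S = {u k [^] i \<otimes> v k [^] j | (i::nat) (j::nat). i + j > 0}"
    have S: "S \<subseteq> carrier G" unfolding S_def by auto
    have "a \<otimes> b \<in> S" if ab: "a \<in> S" "b \<in> S" for a b
    proof -
      obtain i j where 1: "a = u k [^] (i::nat) \<otimes> v k [^] (j::nat)" "i + j > 0" using ab unfolding S_def by blast
      obtain i' j' where 2: "b = u k [^] (i'::nat) \<otimes> v k [^] (j'::nat)" "i' + j' > 0" using ab unfolding S_def by blast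
      have "a \<otimes> b = u k [^] (i + i') \<otimes> v k [^] (j + j')"
        using 1(1) 2(1) by (simp add: m_ac flip: nat_pow_mult)
      moreover have "i + i' + (j + j') > 0" using 1 by linarith
      ultimately show ?thesis unfolding S_def by blast
    qed
    moreover have "\<one> \<notin> S"
    proof
      assume "\<one> \<in> S"
      then obtain i j where ij: "\<one> = u k [^] (i::nat) \<otimes> v k [^] (j::nat)" "i + j > 0" unfolding S_def by blast
      \<comment> \<open>The exponent of x forces i = j, and then the exponent of y is (k + 1) j - k
        j = j.\<close>
      hence "x [^] (int i - int j) \<otimes> y [^] ((int k + 1) * int j - int k * int i) = \<one>"
        using slope_product[OF xy, of "int k" "int i" "int k + 1" "int j"] by (simp only: u_def v_def int_pow_int)
      from indep[OF this] have "int i = int j" "(int k + 1) * int j - int k * int i = 0" by auto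
      hence "int j = 0" by (simp add: algebra_simps)
      thus False using ij(2) \<open>int i = int j\<close> by simp
    qed
    ultimately obtain P where P: "S \<subseteq> P" "pos_cone G (carrier G) P"
      using S by - (rule extend_semigroup_to_cone[where S = S], (use tf in blast)+)
    have mem: "u k [^] i \<otimes> v k [^] j \<in> S" if "i + j > 0" for i j :: nat using that unfolding S_def by blast
    have "u k \<in> S" "v k \<in> S" using mem[of 1 0] mem[of 0 1] by auto
    thus ?thesis using P by blast
  qed
  then obtain P where P: "\<And>k. pos_cone G (carrier G) (P k)" "\<And>k. u k \<in> P k" "\<And>k. v k \<in> P k" by metis
  have neq: "P k \<noteq> P l" if kl: "k < l" for k l
  proof
    assume eq: "P k = P l"
    interpret cone_group G "carrier G" "P l" by unfold_locales (use P subgroup_self in auto)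
    have "u l \<otimes> v l = y"
      using slope_product[OF xy, of "int l" 1 "int l + 1" 1] by (simp add: u_def v_def del: int_pow_mult)
    hence y: "y \<in> P l" using P(2)[of l] P(3)[of l] P_mult by metis
    \<comment> \<open>Here \<open>u l\<close> says x > y^l and \<open>v k\<close> says x < y^(k+1),
      which clash as k + 1 <= l and y is positive. If l = k + 1 the product is the identity itself;
      this is the case m = 0 below.\<close>
    have "u l \<otimes> v k = y [^] (int k + 1 - int l)"
      using slope_product[OF xy, of "int l" 1 "int k + 1" 1] by (simp add: u_def v_def)
    hence 1: "y [^] (int k + 1 - int l) \<in> P l" using P(2)[of l] P(3)[of k] eq P_mult by metis
    define m where "m = l - k - 1"
    have m: "int k + 1 - int l = - int m" using kl by (simp add: m_def)
    have 2: "y [^] m = \<one> \<or> y [^] m \<in> P l"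
      using P_pow[OF y, of m] by (cases m) auto
    have "y [^] (int k + 1 - int l) \<otimes> y [^] m = \<one>"
      unfolding m by (simp add: int_pow_neg int_pow_int)
    thus False using 1 2 P_mult[OF 1, of "y [^] m"] one_notin_P by auto
  qed
  have "inj P"
  proof (rule injI)
    fix k l assume "P k = P l"
    thus "k = l" using neq[of k l] neq[of l k] by (cases k l rule: linorder_cases) auto
  qed
  hence "infinite (range P)" by (rule range_inj_infinite)
  moreover have "range P \<subseteq> {P. pos_cone G (carrier G) P}" using P(1) by blast
  ultimately show ?thesis using finite_subset by blast
qed

end

lemma tf_rank_one_card_cones:
  assumes "tf_rank_one A"
  shows "card {P. pos_cone A (carrier A) P} = 2"
proof -
  interpret comm_group A using assms by (simp add: tf_rank_one_def)
  show ?thesis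
  proof (rule rank_one_card_cones)
    show "x = \<one>\<^bsub>A\<^esub>" if "x \<in> carrier A" "x [^]\<^bsub>A\<^esub> n = \<one>\<^bsub>A\<^esub>" "n > 0" for x and n :: nat
    proof -
      have "x [^]\<^bsub>A\<^esub> int n = \<one>\<^bsub>A\<^esub>" "int n \<noteq> 0" using that by (simp_all add: int_pow_int)
      thus ?thesis using assms that(1) unfolding tf_rank_one_def by blast
    qed
  qed (use assms in \<open>auto simp: tf_rank_one_def\<close>)
qed

text \<open>The given cone makes the group torsion-free; two independent elements would produce
  infinitely many cones.\<close>

lemma tf_rank_one_if_finite_cones:
  assumes "comm_group A" and P: "pos_cone A (carrier A) P"
    and fin: "finite {P. pos_cone A (carrier A) P}" and nt: "carrier A \<noteq> {\<one>\<^bsub>A\<^esub>}"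
  shows "tf_rank_one A"
proof -
  interpret comm_group A by fact
  interpret cone_group A "carrier A" P by unfold_locales (use P subgroup_self in auto)
  have tf: "x = \<one>\<^bsub>A\<^esub>" if "x \<in> carrier A" "x [^]\<^bsub>A\<^esub> k = \<one>\<^bsub>A\<^esub>" "k \<noteq> 0" for x and k :: int
    using convex_isolated[OF convex_one that(1)] that by auto
  have "\<exists>(a::int) (b::int). (a \<noteq> 0 \<or> b \<noteq> 0) \<and> x [^]\<^bsub>A\<^esub> a \<otimes>\<^bsub>A\<^esub> y [^]\<^bsub>A\<^esub> b = \<one>\<^bsub>A\<^esub>"
    if xy: "x \<in> carrier A" "y \<in> carrier A" for x y
  proof (rule ccontr)
    assume "\<not> ?thesis"
    hence "infinite {P. pos_cone A (carrier A) P}"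
      by (intro independent_infinite_cones[OF _ xy]) (use torsion_free in blast)+
    thus False using fin by blast
  qed
  thus ?thesis using assms(1) nt tf unfolding tf_rank_one_def by blast
qed

subsection \<open>Quotients by convex normal subgroups\<close>

context group
begin

lemma cone_groupI: "subgroup H G \<Longrightarrow> pos_cone G H P \<Longrightarrow> cone_group G H P"
  by (intro cone_group.intro cone_group_axioms.intro is_group)

lemma conrad_groupI: "subgroup H G \<Longrightarrow> conrad_cone G H P \<Longrightarrow> conrad_group G H P"
  by (intro conrad_group.intro conrad_group_axioms.intro cone_groupI) (auto simp: conrad_cone_def)

end

declare mult_FactGroup [simp del] one_FactGroup [simp del]

text \<open>Normality is asked in \<open>D\<close> only, while the ambient group remains
  \<open>G\<close>. Quotients of different pairs can thus be compared through elements of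
  \<open>G\<close>.\<close>

locale normal_pair = group G for G (structure) +
  fixes C D :: "'a set"
  assumes subgroup_D: "subgroup D G"
    and normal_C: "C \<lhd> G\<lparr>carrier := D\<rparr>"
begin

abbreviation Q where "Q \<equiv> G\<lparr>carrier := D\<rparr> Mod C"

sublocale D: subgroup D G using subgroup_D .

lemma subgroup_C: "subgroup C G"
  using incl_subgroup[OF subgroup_D] normal_imp_subgroup[OF normal_C] .

sublocale C: subgroup C G using subgroup_C .

lemma C_D: "C \<subseteq> D"
  using subgroup.subset[OF normal_imp_subgroup[OF normal_C]] by simp

lemma D_carrier [simp, intro]: "x \<in> D \<Longrightarrow> x \<in> carrier G"
  using D.mem_carrier .

lemma group_Q: "group Q"
  using normal.factorgroup_is_group[OF normal_C] .

definition proj :: "'a \<Rightarrow> 'a set" where "proj x = C #> x"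

definition lift :: "'a set set \<Rightarrow> 'a set" where "lift R = {x \<in> D. proj x \<in> R}"

lemma proj_hom: "group_hom (G\<lparr>carrier := D\<rparr>) Q proj"
proof -
  have "proj = (\<lambda>x. C #>\<^bsub>G\<lparr>carrier := D\<rparr>\<^esub> x)" by (auto simp: proj_def r_coset_def fun_eq_iff)
  hence "proj \<in> hom (G\<lparr>carrier := D\<rparr>) Q" using normal.r_coset_hom_Mod[OF normal_C] by simp
  thus ?thesis using group_Q D.subgroup_is_group[OF group_axioms]
    by (simp add: group_hom_def group_hom_axioms_def)
qed

sublocale proj: group_hom "G\<lparr>carrier := D\<rparr>" Q proj using proj_hom .

lemma carrier_Q: "carrier Q = proj ` D"
  by (auto simp: FactGroup_def RCOSETS_def proj_def r_coset_def)

lemma proj_mult: "\<lbrakk>x \<in> D; y \<in> D\<rbrakk> \<Longrightarrow> proj (x \<otimes> y) = proj x \<otimes>\<^bsub>Q\<^esub> proj y"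
  using proj.hom_mult[of x y] by simp

lemma proj_inv: "x \<in> D \<Longrightarrow> proj (inv x) = inv\<^bsub>Q\<^esub> (proj x)"
  using proj.hom_inv[of x] m_inv_consistent[OF subgroup_D] by simp

lemma proj_nat_pow: "x \<in> D \<Longrightarrow> proj (x [^] (n::nat)) = proj x [^]\<^bsub>Q\<^esub> n"
  using proj.hom_nat_pow[of x n] nat_pow_consistent[of x n D] by simp

lemma proj_int_pow: "x \<in> D \<Longrightarrow> proj (x [^] (n::int)) = proj x [^]\<^bsub>Q\<^esub> n"
  using proj.hom_int_pow[of x n] int_pow_consistent[OF subgroup_D, of x n] by simp

lemma D_nat_pow: "x \<in> D \<Longrightarrow> x [^] (n::nat) \<in> D"
  by (induction n) auto

lemma D_int_pow: "x \<in> D \<Longrightarrow> x [^] (n::int) \<in> D"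
  using int_pow_consistent[OF subgroup_D, of x n] group.int_pow_closed[OF proj.G.is_group, of x n] by simp

lemma proj_one_iff: "x \<in> D \<Longrightarrow> proj x = \<one>\<^bsub>Q\<^esub> \<longleftrightarrow> x \<in> C"
  unfolding proj_def one_FactGroup using coset_join1[of C x] coset_join2[of x C] subgroup_C by auto

lemma proj_eqD: "\<lbrakk>x \<in> D; y \<in> D; proj x = proj y\<rbrakk> \<Longrightarrow> x \<otimes> inv y \<in> C"
  using proj_one_iff[of "x \<otimes> inv y"] proj_mult[of x "inv y"] proj_inv[of y]
    proj.H.r_inv[of "proj y"] carrier_Q by auto

lemma conj_C: "\<lbrakk>x \<in> D; c \<in> C\<rbrakk> \<Longrightarrow> inv x \<otimes> c \<otimes> x \<in> C"
  using normal.inv_op_closed1[OF normal_C, of x c] m_inv_consistent[OF subgroup_D] by simp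

text \<open>Stated with commutators so that abelian quotients with different denominators can be
  combined: a commutator lying in both denominators lies in their intersection.\<close>

lemma comm_group_Q_iff: "comm_group Q \<longleftrightarrow> (\<forall>x\<in>D. \<forall>y\<in>D. x \<otimes> y \<otimes> inv (y \<otimes> x) \<in> C)"
proof -
  have *: "x \<otimes> y \<otimes> inv (y \<otimes> x) \<in> C \<longleftrightarrow> proj x \<otimes>\<^bsub>Q\<^esub> proj y = proj y \<otimes>\<^bsub>Q\<^esub> proj x"
    if xy: "x \<in> D" "y \<in> D" for x y
  proof
    assume c: "x \<otimes> y \<otimes> inv (y \<otimes> x) \<in> C"
    have d: "y \<otimes> x \<in> D" "x \<otimes> y \<in> D" using xy by auto
    have "proj (x \<otimes> y) = proj ((x \<otimes> y \<otimes> inv (y \<otimes> x)) \<otimes> (y \<otimes> x))"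
      using d by (simp add: m_assoc)
    also have "\<dots> = proj (x \<otimes> y \<otimes> inv (y \<otimes> x)) \<otimes>\<^bsub>Q\<^esub> proj (y \<otimes> x)"
      using d c C_D by (intro proj_mult) auto
    also have "proj (x \<otimes> y \<otimes> inv (y \<otimes> x)) = \<one>\<^bsub>Q\<^esub>" using proj_one_iff c C_D by auto
    finally have "proj (x \<otimes> y) = proj (y \<otimes> x)"
      using proj.H.l_one[of "proj (y \<otimes> x)"] d carrier_Q by auto
    thus "proj x \<otimes>\<^bsub>Q\<^esub> proj y = proj y \<otimes>\<^bsub>Q\<^esub> proj x" using proj_mult xy by simp
  next
    assume "proj x \<otimes>\<^bsub>Q\<^esub> proj y = proj y \<otimes>\<^bsub>Q\<^esub> proj x"
    hence "proj (x \<otimes> y) = proj (y \<otimes> x)" using proj_mult xy by simp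
    thus "x \<otimes> y \<otimes> inv (y \<otimes> x) \<in> C" using proj_eqD xy by blast
  qed
  show ?thesis
  proof
    assume "comm_group Q"
    then interpret Q: comm_group Q .
    show "\<forall>x\<in>D. \<forall>y\<in>D. x \<otimes> y \<otimes> inv (y \<otimes> x) \<in> C"
    proof (intro ballI)
      fix x y assume xy: "x \<in> D" "y \<in> D"
      hence "proj x \<in> carrier Q" "proj y \<in> carrier Q" using carrier_Q by auto
      from Q.m_comm[OF this] show "x \<otimes> y \<otimes> inv (y \<otimes> x) \<in> C" using *[OF xy] by blast
    qed
  next
    assume a: "\<forall>x\<in>D. \<forall>y\<in>D. x \<otimes> y \<otimes> inv (y \<otimes> x) \<in> C"
    show "comm_group Q"
    proof (rule group.group_comm_groupI[OF group_Q])
      fix X' Y' assume "X' \<in> carrier Q" "Y' \<in> carrier Q"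
      then obtain x y where "x \<in> D" "y \<in> D" "X' = proj x" "Y' = proj y" using carrier_Q by auto
      thus "X' \<otimes>\<^bsub>Q\<^esub> Y' = Y' \<otimes>\<^bsub>Q\<^esub> X'" using a *[of x y] by simp
    qed
  qed
qed

lemma tf_rank_oneD:
  assumes "tf_rank_one Q"
  shows "comm_group Q" "C \<noteq> D" "\<And>x y. x \<in> D \<Longrightarrow> y \<in> D \<Longrightarrow>
      \<exists>(a::int) (b::int). (a \<noteq> 0 \<or> b \<noteq> 0) \<and> x [^] a \<otimes> y [^] b \<in> C"
    "\<And>x k. \<lbrakk>x \<in> D; k \<noteq> (0::int); x [^] k \<in> C\<rbrakk> \<Longrightarrow> x \<in> C"
proof -
  show "comm_group Q" using assms by (simp add: tf_rank_one_def)
  show "C \<noteq> D"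
  proof
    assume "C = D"
    hence "carrier Q \<subseteq> {\<one>\<^bsub>Q\<^esub>}" using carrier_Q proj_one_iff by auto
    hence "carrier Q = {\<one>\<^bsub>Q\<^esub>}" using proj.H.one_closed by blast
    thus False using assms unfolding tf_rank_one_def by blast
  qed
  show "\<exists>(a::int) (b::int). (a \<noteq> 0 \<or> b \<noteq> 0) \<and> x [^] a \<otimes> y [^] b \<in> C" if "x \<in> D" "y \<in> D" for x y
  proof -
    have "proj x \<in> carrier Q" "proj y \<in> carrier Q" using that carrier_Q by auto
    with assms have "\<exists>(a::int) (b::int). (a \<noteq> 0 \<or> b \<noteq> 0) \<and> proj x [^]\<^bsub>Q\<^esub> a \<otimes>\<^bsub>Q\<^esub> proj y [^]\<^bsub>Q\<^esub> b = \<one>\<^bsub>Q\<^esub>"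
      unfolding tf_rank_one_def by simp
    then obtain a b :: int where ab: "a \<noteq> 0 \<or> b \<noteq> 0" "proj x [^]\<^bsub>Q\<^esub> a \<otimes>\<^bsub>Q\<^esub> proj y [^]\<^bsub>Q\<^esub> b = \<one>\<^bsub>Q\<^esub>"
      by blast
    have "proj (x [^] a \<otimes> y [^] b) = \<one>\<^bsub>Q\<^esub>"
      using ab(2) that by (simp add: proj_mult D_int_pow proj_int_pow)
    hence "x [^] a \<otimes> y [^] b \<in> C" using proj_one_iff[of "x [^] a \<otimes> y [^] b"] that D_int_pow by auto
    thus ?thesis using ab(1) by blast
  qed
  show "x \<in> C" if x: "x \<in> D" "k \<noteq> (0::int)" "x [^] k \<in> C" for x k
  proof -
    have "proj x [^]\<^bsub>Q\<^esub> k = \<one>\<^bsub>Q\<^esub>"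
      using proj_int_pow[OF x(1)] proj_one_iff[OF D_int_pow[OF x(1)]] x(3) by simp
    moreover have "proj x \<in> carrier Q" using x(1) carrier_Q by blast
    moreover have "\<forall>x\<in>carrier Q. \<forall>k::int. k \<noteq> 0 \<and> x [^]\<^bsub>Q\<^esub> k = \<one>\<^bsub>Q\<^esub> \<longrightarrow> x = \<one>\<^bsub>Q\<^esub>"
      using assms unfolding tf_rank_one_def by (elim conjE) assumption
    ultimately have "proj x = \<one>\<^bsub>Q\<^esub>" using x(2) by blast
    thus ?thesis using proj_one_iff x(1) by simp
  qed
qed

text \<open>This is the lexicographic order: cosets of \<open>C\<close> are compared before
  \<open>P\<close> is consulted. If f and g both lie in \<open>P\<close>, the Conradian exponent
  comes from \<open>P\<close>. Otherwise 1 or 2 suffices, by normality of \<open>C\<close> when f is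
  in \<open>P\<close>, and by commutativity of the quotient when neither is.\<close>

lemma lift_lex:
  assumes P: "conrad_cone G C P" and Q: "comm_group Q" and R: "pos_cone Q (carrier Q) R"
  shows "conrad_cone G D (P \<union> lift R)"
proof -
  interpret Q: comm_group Q by fact
  interpret P: cone_group G C P using P cone_groupI subgroup_C by (simp add: conrad_cone_def)
  interpret R: cone_group Q "carrier Q" R using R proj.H.cone_groupI proj.H.subgroup_self by blast
  have PD: "x \<in> D" if "x \<in> P" for x using that P.P_H C_D by blast
  have RD: "x \<in> D" "proj x \<in> R" if "x \<in> lift R" for x using that by (auto simp: lift_def)
  have projP: "proj x = \<one>\<^bsub>Q\<^esub>" if "x \<in> C" for x using that C_D proj_one_iff by auto
  have lift1: "x \<otimes> y \<in> lift R" if "x \<in> lift R" "y \<in> lift R" for x y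
    using that proj_mult R.P_mult by (auto simp: lift_def)
  have lift2: "c \<otimes> y \<in> lift R" if "c \<in> C" "y \<in> lift R" for c y
    using that proj_mult[of c y] projP C_D R.P_carrier by (auto simp: lift_def)
  have lift3: "y \<otimes> c \<in> lift R" if "c \<in> C" "y \<in> lift R" for c y
    using that proj_mult[of y c] projP C_D R.P_carrier by (auto simp: lift_def)
  have "\<one> \<notin> lift R" using R.one_notin_P projP[of \<one>] by (auto simp: lift_def)
  moreover have "x = \<one> \<or> x \<in> P \<union> lift R \<or> inv x \<in> P \<union> lift R" if x: "x \<in> D" for x
  proof (cases "x \<in> C")
    case True thus ?thesis using P.P_total by blast
  next
    case False
    hence "proj x \<in> R \<or> inv\<^bsub>Q\<^esub> (proj x) \<in> R"
      using R.P_total[of "proj x"] proj_one_iff x carrier_Q by auto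
    thus ?thesis using x proj_inv by (auto simp: lift_def)
  qed
  ultimately have "pos_cone G D (P \<union> lift R)"
    unfolding pos_cone_def using PD RD lift1 lift2 lift3 P.P_H by auto
  moreover have "\<exists>n::nat. inv g \<otimes> f \<otimes> g [^] n \<in> P \<union> lift R"
    if f: "f \<in> P \<union> lift R" and g: "g \<in> P \<union> lift R" for f g
  proof -
    have fg [simp]: "f \<in> D" "g \<in> D" using f g PD RD by auto
    show ?thesis
    proof (cases "g \<in> P")
      case gP: True
      show ?thesis
      proof (cases "f \<in> P")
        case True thus ?thesis using P gP unfolding conrad_cone_def by blast
      next
        case False
        hence "inv g \<otimes> f \<otimes> g [^] (1::nat) \<in> lift R"
          using f gP lift2[of "inv g" f] lift3[of g "inv g \<otimes> f"] P.P_H by simp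
        thus ?thesis by blast
      qed
    next
      case False
      hence gR: "g \<in> lift R" using g by blast
      have sq: "g [^] (2::nat) = g \<otimes> g" by (simp add: numeral_2_eq_2)
      show ?thesis
      proof (cases "f \<in> P")
        case True
        hence "inv g \<otimes> f \<otimes> g \<in> C" using conj_C P.P_H by simp
        hence "inv g \<otimes> f \<otimes> g \<otimes> g \<in> lift R" using lift2 gR by blast
        hence "inv g \<otimes> f \<otimes> g [^] (2::nat) \<in> lift R" unfolding sq by (simp add: m_assoc)
        thus ?thesis by blast
      next
        case False
        hence fR: "f \<in> lift R" using f by blast
        have pc: "proj f \<in> carrier Q" "proj g \<in> carrier Q" using carrier_Q by auto
        have "proj (inv g \<otimes> (f \<otimes> (g \<otimes> g))) = inv\<^bsub>Q\<^esub> (proj g) \<otimes>\<^bsub>Q\<^esub> (proj f \<otimes>\<^bsub>Q\<^esub> (proj g \<otimes>\<^bsub>Q\<^esub> proj g))"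
          by (simp add: proj_mult proj_inv)
        also have "proj f \<otimes>\<^bsub>Q\<^esub> (proj g \<otimes>\<^bsub>Q\<^esub> proj g) = proj g \<otimes>\<^bsub>Q\<^esub> (proj f \<otimes>\<^bsub>Q\<^esub> proj g)"
          by (rule Q.m_lcomm[OF pc(1) pc(2) pc(2)])
        also have "inv\<^bsub>Q\<^esub> (proj g) \<otimes>\<^bsub>Q\<^esub> \<dots> = proj f \<otimes>\<^bsub>Q\<^esub> proj g"
          by (rule group.mult_inv_cancel_left(2)[OF group_Q pc(2) proj.H.m_closed[OF pc]])
        also have "\<dots> = proj (f \<otimes> g)" by (simp add: proj_mult)
        finally have "proj (inv g \<otimes> f \<otimes> g [^] (2::nat)) \<in> R"
          using lift1[OF fR gR] unfolding sq by (simp add: m_assoc lift_def)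
        hence "inv g \<otimes> f \<otimes> g [^] (2::nat) \<in> lift R" unfolding lift_def sq by simp
        thus ?thesis by blast
      qed
    qed
  qed
  ultimately show ?thesis unfolding conrad_cone_def by blast
qed

lemma lift_disjoint:
  assumes "pos_cone Q (carrier Q) R"
  shows "lift R \<inter> C = {}"
proof -
  have "\<one>\<^bsub>Q\<^esub> \<notin> R" using assms unfolding pos_cone_def by blast
  moreover have "proj x = \<one>\<^bsub>Q\<^esub>" if "x \<in> C" for x using that proj_one_iff C_D by blast
  ultimately show ?thesis unfolding lift_def by force
qed

lemma convex_lift_lex:
  assumes P: "pos_cone G C P" and R: "pos_cone Q (carrier Q) R"
  shows "convex_in G D (P \<union> lift R) C"
  unfolding convex_in_def
proof (intro conjI ballI impI)
  show "subgroup C G" "C \<subseteq> D" using subgroup_C C_D by auto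
  interpret R: cone_group Q "carrier Q" R using R proj.H.cone_groupI proj.H.subgroup_self by blast
  fix g c assume g: "g \<in> P \<union> lift R" and c: "c \<in> C" and gc: "inv g \<otimes> c \<in> P \<union> lift R"
  show "g \<in> C"
  proof (rule ccontr)
    assume gC: "g \<notin> C"
    hence gR: "g \<in> D" "proj g \<in> R" using g P unfolding pos_cone_def lift_def by auto
    have "inv g \<otimes> c \<notin> C"
    proof
      assume "inv g \<otimes> c \<in> C"
      hence "inv g \<otimes> c \<otimes> inv c \<in> C" using c by blast
      hence "inv g \<in> C" using c gR by (simp add: m_assoc)
      from C.m_inv_closed[OF this] show False using gC gR by simp
    qed
    hence "proj (inv g \<otimes> c) \<in> R" using gc P unfolding pos_cone_def lift_def by auto
    moreover have "proj (inv g \<otimes> c) = inv\<^bsub>Q\<^esub> (proj g)"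
      using proj_mult[of "inv g" c] proj_inv[of g] proj_one_iff[of c] gR c C_D carrier_Q
        proj.H.r_one proj.H.inv_closed by (metis D.m_inv_closed imageI subsetD)
    ultimately show False using R.P_inv_notin gR by metis
  qed
qed

text \<open>The sign is constant on each nontrivial coset of a convex subgroup, so the cone
  descends. The second claim says that nothing is lost: \<open>P\<close> is lexicographic over its
  restriction to \<open>C\<close>.\<close>

lemma quotient_cone:
  assumes P: "pos_cone G D P" and cv: "convex_in G D P C"
  shows "pos_cone Q (carrier Q) (proj ` (P - C))" "lift (proj ` (P - C)) = P - C"
proof -
  interpret P: cone_group G D P using cone_groupI subgroup_D P .
  have mult: "p \<otimes> q \<in> P - C" if p: "p \<in> P - C" and q: "q \<in> P - C" for p q
    using P.convexD(3)[OF cv, of p "p \<otimes> q"] p q by auto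
  have PD: "p \<in> D" if "p \<in> P" for p using that P.P_H by blast
  show "pos_cone Q (carrier Q) (proj ` (P - C))"
    unfolding pos_cone_def
  proof (intro conjI ballI)
    show "proj ` (P - C) \<subseteq> carrier Q" using PD carrier_Q by auto
    have "proj p \<noteq> \<one>\<^bsub>Q\<^esub>" if "p \<in> P - C" for p using proj_one_iff[OF PD, of p] that by simp
    thus "\<one>\<^bsub>Q\<^esub> \<notin> proj ` (P - C)" by force
    show "x \<otimes>\<^bsub>Q\<^esub> y \<in> proj ` (P - C)" if xy_mem: "x \<in> proj ` (P - C)" "y \<in> proj ` (P - C)" for x y
    proof -
      obtain p q where pq: "p \<in> P - C" "q \<in> P - C" and xy: "x = proj p" "y = proj q"
        using xy_mem by blast
      have "x \<otimes>\<^bsub>Q\<^esub> y = proj (p \<otimes> q)" using proj_mult[of p q] PD pq xy by simp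
      thus ?thesis using mult[OF pq] by blast
    qed
    show "x = \<one>\<^bsub>Q\<^esub> \<or> x \<in> proj ` (P - C) \<or> inv\<^bsub>Q\<^esub> x \<in> proj ` (P - C)" if "x \<in> carrier Q" for x
    proof -
      obtain p where p: "p \<in> D" "x = proj p" using \<open>x \<in> carrier Q\<close> carrier_Q by auto
      show ?thesis
      proof (cases "p \<in> C")
        case True thus ?thesis using p proj_one_iff by simp
      next
        case False
        hence "inv p \<notin> C" using C.m_inv_closed[of "inv p"] p by auto
        moreover have "p \<in> P \<or> inv p \<in> P" using P.P_total[OF p(1)] False by auto
        ultimately have "proj p \<in> proj ` (P - C) \<or> proj (inv p) \<in> proj ` (P - C)" using False by blast
        thus ?thesis unfolding p(2) proj_inv[OF p(1)] by blast
      qed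
    qed
  qed
  show "lift (proj ` (P - C)) = P - C"
  proof
    show "P - C \<subseteq> lift (proj ` (P - C))" unfolding lift_def using PD by blast
    show "lift (proj ` (P - C)) \<subseteq> P - C"
    proof
      fix x assume "x \<in> lift (proj ` (P - C))"
      then obtain p where p: "x \<in> D" "p \<in> P" "p \<notin> C" "proj x = proj p" unfolding lift_def by blast
      have "x \<otimes> inv p \<in> C" using proj_eqD p PD by blast
      from P.convex_absorb(1,2)[OF cv p(2,3) this] show "x \<in> P - C" using p by (simp add: m_assoc)
    qed
  qed
qed

end

lemma (in group) normal_pairI:
  assumes C: "subgroup C G" and D: "subgroup D G" and CD: "C \<subseteq> D"
    and conj: "\<And>x c. x \<in> D \<Longrightarrow> c \<in> C \<Longrightarrow> x \<otimes> c \<otimes> inv x \<in> C"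
  shows "normal_pair G C D"
proof -
  have grp: "group (G\<lparr>carrier := D\<rparr>)" using subgroup.subgroup_is_group[OF D is_group] .
  have "C \<lhd> G\<lparr>carrier := D\<rparr>"
    unfolding group.normal_inv_iff[OF grp]
    using subgroup_incl[OF C D CD] conj m_inv_consistent[OF D] by simp
  thus ?thesis by (intro normal_pair.intro normal_pair_axioms.intro is_group D)
qed

section \<open>Changing a cone inside a convex subgroup; jumps are abelian\<close>

context conrad_group
begin

text \<open>The cone on a convex \<open>D\<close> can be exchanged freely because signs outside
  \<open>D\<close> depend only on cosets. The Conradian condition is the delicate part, as
  \<open>P\<close> and \<open>P1\<close> may disagree on \<open>D\<close>.\<close>

lemma surgery:
  assumes D: "convex D" and P1: "conrad_cone G D P1"
  shows "conrad_cone G H (P1 \<union> (P - D))"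
proof -
  interpret D: subgroup D G using convexD(1)[OF D] .
  interpret P1: cone_group G D P1 using P1 cone_groupI D.subgroup_axioms by (simp add: conrad_cone_def)
  note absorb = convex_absorb[OF D]
  have mult: "p \<otimes> q \<in> P - D" if p: "p \<in> P - D" and q: "q \<in> P - D" for p q
    using convexD(3)[OF D, of p "p \<otimes> q"] p q by auto
  have up: "x \<otimes> g \<in> P - D" if "x \<in> P" "g \<in> P - D" for x g
    using absorb(1,2)[of g x] mult[of x g] that by blast
  have "pos_cone G H (P1 \<union> (P - D))"
    unfolding pos_cone_def
  proof (intro conjI ballI)
    show "P1 \<union> (P - D) \<subseteq> H" using P1.P_H convexD(2)[OF D] P_H by blast
    show "\<one> \<notin> P1 \<union> (P - D)" by simp
    fix x y assume x: "x \<in> P1 \<union> (P - D)" and y: "y \<in> P1 \<union> (P - D)"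
    show "x \<otimes> y \<in> P1 \<union> (P - D)"
    proof (cases "x \<in> P1"; cases "y \<in> P1")
      assume "x \<in> P1" "y \<in> P1" thus ?thesis using P1.P_mult by simp
    next
      assume "x \<in> P1" "y \<notin> P1" thus ?thesis using absorb(1,2)[of y x] y P1.P_H by simp
    next
      assume "x \<notin> P1" "y \<in> P1" thus ?thesis using absorb(3,4)[of x y] x P1.P_H by simp
    next
      assume "x \<notin> P1" "y \<notin> P1" thus ?thesis using mult[of x y] x y by simp
    qed
  next
    fix x assume x: "x \<in> H"
    show "x = \<one> \<or> x \<in> P1 \<union> (P - D) \<or> inv x \<in> P1 \<union> (P - D)"
    proof (cases "x \<in> D")
      case True thus ?thesis using P1.P_total by blast
    next
      case False
      hence "inv x \<notin> D" using D.m_inv_closed[of "inv x"] x by auto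
      thus ?thesis using P_total[OF x] False by blast
    qed
  qed
  moreover have "\<exists>n::nat. inv g \<otimes> f \<otimes> g [^] n \<in> P1 \<union> (P - D)"
    if f: "f \<in> P1 \<union> (P - D)" and g: "g \<in> P1 \<union> (P - D)" for f g
  proof (cases "g \<in> P1")
    case gP1: True
    show ?thesis
    proof (cases "f \<in> P1")
      case True thus ?thesis using P1 gP1 unfolding conrad_cone_def by blast
    next
      case False
      hence "f \<in> P" "f \<notin> D" "g \<in> D" using f gP1 P1.P_H by auto
      hence "inv g \<otimes> f \<otimes> g \<in> P - D"
        using absorb(1,2)[of f "inv g"] absorb(3,4)[of "inv g \<otimes> f" g] by simp
      moreover have "g [^] (1::nat) = g" using \<open>g \<in> D\<close> by simp
      ultimately show ?thesis by (metis UnI2)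
    qed
  next
    case False
    hence gP: "g \<in> P - D" using g by blast
    have [simp]: "g \<in> carrier G" using gP by auto
    \<comment> \<open>An f from \<open>P1\<close> may be negative for \<open>P\<close>, but f g is
      positive. The condition for f g and g may still yield an element of \<open>D\<close>, where
      \<open>P1\<close> decides; one more factor g leads out of \<open>D\<close>, whence the
      exponent n + 2.\<close>
    have fgP: "f \<otimes> g \<in> P"
      using f absorb(1)[of g f] gP P1.P_H P_mult by blast
    have fC [simp]: "f \<in> carrier G" using f P1.P_H D.mem_carrier by blast
    obtain n :: nat where "inv g \<otimes> (f \<otimes> g) \<otimes> g [^] n \<in> P" using conrad[OF fgP, of g] gP by blast
    hence "inv g \<otimes> (f \<otimes> g) \<otimes> g [^] n \<otimes> g \<in> P - D" using up gP by blast
    moreover have "inv g \<otimes> (f \<otimes> g) \<otimes> g [^] n \<otimes> g = inv g \<otimes> f \<otimes> g [^] (n + 2)"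
    proof -
      have "g [^] (n + 2) = g \<otimes> (g [^] n \<otimes> g)"
        using nat_pow_Suc2[of g "Suc n"] by simp
      thus ?thesis by (simp add: m_assoc)
    qed
    ultimately show ?thesis by (metis UnI2)
  qed
  ultimately show ?thesis unfolding conrad_cone_def by blast
qed

lemma jump_normal:
  assumes g: "g \<in> P"
  shows "normal_pair G (low g) (arch g)"
proof -
  have A: "subgroup (arch g) G" using convexD(1)[OF convex_arch[OF g]] .
  have L: "subgroup (low g) G" using convexD(1)[OF convex_low[OF g]] .
  show ?thesis using normal_pairI[OF L A low_le_arch[OF g]] low_conj_closed[OF g] by blast
qed

lemma jump_cone:
  assumes g: "g \<in> P"
  shows "pos_cone G (arch g) (P \<inter> arch g)" "convex_in G (arch g) (P \<inter> arch g) (low g)"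
proof -
  have A: "subgroup (arch g) G" "arch g \<subseteq> H" using convexD[OF convex_arch[OF g]] by auto
  show "pos_cone G (arch g) (P \<inter> arch g)"
    using restrict_cone[OF A] cone_group.cone by blast
  have "low g \<inter> arch g = low g" using low_le_arch[OF g] by blast
  thus "convex_in G (arch g) (P \<inter> arch g) (low g)"
    using convex_restrict[OF convex_low[OF g] A] by simp
qed

text \<open>Powers of a positive element outside \<open>low g\<close> are cofinal in
  \<open>arch g\<close>, so the quotient is Archimedean and \<open>hoelder\<close> applies.\<close>

theorem jump_comm_group:
  assumes g: "g \<in> P"
  shows "comm_group (G\<lparr>carrier := arch g\<rparr> Mod low g)"
proof -
  interpret N: normal_pair G "low g" "arch g" using jump_normal[OF g] .
  let ?R = "N.proj ` (P \<inter> arch g - low g)"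
  note R = N.quotient_cone[OF jump_cone[OF g]]
  interpret R: cone_group N.Q "carrier N.Q" ?R
    using R(1) N.proj.H.cone_groupI N.proj.H.subgroup_self by blast
  have "\<exists>n::nat. R.lt x (h [^]\<^bsub>N.Q\<^esub> n)" if h: "h \<in> ?R" and x: "x \<in> carrier N.Q" for h x
  proof -
    obtain k where k: "k \<in> P" "k \<in> arch g" "k \<notin> low g" "h = N.proj k" using h by blast
    obtain y where y: "y \<in> arch g" "x = N.proj y" using x N.carrier_Q by auto
    obtain n :: nat where n: "lt y (k [^] n)" using arch_cofinal[OF g k(1-3) y(1)] by blast
    \<comment> \<open>This p is positive but may lie in \<open>low g\<close> and so have trivial
      image. Multiplying by k repairs this and raises the exponent to n + 1.\<close>
    define p where "p = inv y \<otimes> k [^] n"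
    have p: "p \<in> P" "p \<in> arch g" using n y k N.D_nat_pow by (auto simp: lt_def p_def)
    have "p \<otimes> k \<in> P" using p k by blast
    moreover have "p \<otimes> k \<notin> low g"
    proof (cases "p \<in> low g")
      case True thus ?thesis using convex_absorb(2)[OF convex_low[OF g] k(1,3)] by blast
    next
      case False thus ?thesis
        using convexD(3)[OF convex_low[OF g] p(1), of "p \<otimes> k"] p k by auto
    qed
    moreover have "p \<otimes> k \<in> arch g" using p k by blast
    ultimately have "N.proj (p \<otimes> k) \<in> ?R" by blast
    also have "p \<otimes> k = inv y \<otimes> k [^] Suc n" using y k by (simp add: p_def m_assoc)
    also have "N.proj (inv y \<otimes> k [^] Suc n) = inv\<^bsub>N.Q\<^esub> x \<otimes>\<^bsub>N.Q\<^esub> h [^]\<^bsub>N.Q\<^esub> Suc n"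
      using y k N.proj_mult N.proj_inv N.proj_nat_pow N.D_nat_pow N.D.m_inv_closed by (simp del: nat_pow_Suc)
    finally show ?thesis unfolding R.lt_def by blast
  qed
  then interpret R: archimedean_group N.Q ?R by unfold_locales
  show ?thesis using R.hoelder .
qed

end

subsection \<open>Convexity of rational series\<close>

context conrad_group
begin

lemma conrad_cone_P: "conrad_cone G H P"
  using cone conrad unfolding conrad_cone_def by blast

lemma restrict_conrad_cone:
  assumes "subgroup D G" "D \<subseteq> H"
  shows "conrad_cone G D (P \<inter> D)"
proof -
  interpret D: subgroup D G by fact
  have pow: "g [^] n \<in> D" if "g \<in> D" for g and n :: nat by (induction n) (use that in auto)
  have "pos_cone G D (P \<inter> D)" using restrict_cone[OF assms] cone_group.cone by blast
  moreover have "\<exists>n::nat. inv g \<otimes> f \<otimes> g [^] n \<in> P \<inter> D" if fg: "f \<in> P \<inter> D" "g \<in> P \<inter> D" for f g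
  proof -
    obtain n :: nat where "inv g \<otimes> f \<otimes> g [^] n \<in> P" using conrad[of f g] fg by blast
    moreover have "inv g \<otimes> f \<otimes> g [^] n \<in> D" using fg pow by simp
    ultimately show ?thesis by blast
  qed
  ultimately show ?thesis unfolding conrad_cone_def by blast
qed

end

text \<open>No convex subgroup stops strictly between \<open>C\<close> and \<open>D\<close>. In a
  relation x^a w^b in \<open>C\<close> the exponent a is nonzero, since otherwise a power of w,
  hence w, would lie in \<open>C\<close>. So x^a is in \<open>K\<close>, and convex subgroups
  contain roots.\<close>

lemma (in cone_group) rank_one_absorb:
  assumes pair: "normal_pair G C D" and tf: "tf_rank_one (G\<lparr>carrier := D\<rparr> Mod C)"
    and K: "convex K" and DH: "D \<subseteq> H" and CK: "C \<subseteq> K" and w: "w \<in> K" "w \<in> D" "w \<notin> C"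
  shows "D \<subseteq> K"
proof
  interpret N: normal_pair G C D by fact
  interpret K: subgroup K G using convexD(1)[OF K] .
  fix x assume x: "x \<in> D"
  obtain a b :: int where ab: "a \<noteq> 0 \<or> b \<noteq> 0" "x [^] a \<otimes> w [^] b \<in> C"
    using N.tf_rank_oneD(3)[OF tf x w(2)] by blast
  have wb: "w [^] b \<in> K" using subgroup_int_pow_closed[OF K.subgroup_axioms w(1)] .
  have [simp]: "x \<in> carrier G" "w \<in> carrier G" using x w by auto
  have "x [^] a \<otimes> w [^] b \<otimes> inv (w [^] b) \<in> K" using ab(2) CK wb by blast
  hence xa: "x [^] a \<in> K" by (simp add: m_assoc)
  have "a \<noteq> 0"
  proof
    assume "a = 0"
    hence "b \<noteq> 0" "w [^] b \<in> C" using ab by auto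
    thus False using N.tf_rank_oneD(4)[OF tf w(2)] w(3) by blast
  qed
  thus "x \<in> K" using convex_isolated[OF K _ xa] x DH by blast
qed

section \<open>Counting cones through lexicographic pairs\<close>

context normal_pair
begin

abbreviation lex_pairs where
  "lex_pairs \<equiv> {P. conrad_cone G C P} \<times> {R. pos_cone Q (carrier Q) R}"

lemma proj_lift:
  assumes "pos_cone Q (carrier Q) R"
  shows "proj ` lift R = R"
proof -
  have "R \<subseteq> proj ` D" using assms carrier_Q unfolding pos_cone_def by simp
  thus ?thesis unfolding lift_def by blast
qed

lemma lex_inj: "inj_on (\<lambda>(P, R). P \<union> lift R) lex_pairs"
proof (rule inj_onI, clarify)
  fix P R P' R'
  assume P: "conrad_cone G C P" "conrad_cone G C P'"
    and R: "pos_cone Q (carrier Q) R" "pos_cone Q (carrier Q) R'"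
    and eq: "P \<union> lift R = P' \<union> lift R'"
  have PC: "P \<subseteq> C" "P' \<subseteq> C" using P unfolding conrad_cone_def pos_cone_def by auto
  have LC: "lift R \<inter> C = {}" "lift R' \<inter> C = {}" using lift_disjoint R by auto
  have "P = (P \<union> lift R) \<inter> C" using PC LC by blast
  also have "\<dots> = P'" unfolding eq using PC LC by blast
  finally have 1: "P = P'" .
  have "lift R = (P \<union> lift R) - C" using PC LC by blast
  also have "\<dots> = lift R'" unfolding eq using PC LC by blast
  finally have "proj ` lift R = proj ` lift R'" by (rule arg_cong)
  hence "R = R'" unfolding proj_lift[OF R(1)] proj_lift[OF R(2)] .
  with 1 show "P = P' \<and> R = R'" by blast
qed

lemma lex_image:
  assumes "comm_group Q"
  shows "(\<lambda>(P, R). P \<union> lift R) ` lex_pairs \<subseteq> {P. conrad_cone G D P}"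
  using lift_lex[OF _ assms] by auto

text \<open>Lexicographic pairs inject into the cones on \<open>D\<close>. The cones
  \<open>P\<close> and \<open>R\<close> witness that neither factor is empty, so finiteness of the
  product passes to both.\<close>

lemma finite_card_lex:
  assumes Q: "comm_group Q" and fin: "finite {P. conrad_cone G D P}"
    and P: "conrad_cone G C P" and R: "pos_cone Q (carrier Q) R"
  shows "finite {P. conrad_cone G C P}" "finite {R. pos_cone Q (carrier Q) R}"
    "card {P. conrad_cone G C P} * card {R. pos_cone Q (carrier Q) R} \<le> card {P. conrad_cone G D P}"
proof -
  have pairs: "finite lex_pairs" using inj_on_finite[OF lex_inj lex_image[OF Q] fin] .
  have ne: "{P. conrad_cone G C P} \<noteq> {}" "{R. pos_cone Q (carrier Q) R} \<noteq> {}" using P R by blast+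
  show "finite {P. conrad_cone G C P}" using finite_cartesian_productD1[OF pairs ne(2)] .
  show "finite {R. pos_cone Q (carrier Q) R}" using finite_cartesian_productD2[OF pairs ne(1)] .
  show "card {P. conrad_cone G C P} * card {R. pos_cone Q (carrier Q) R} \<le> card {P. conrad_cone G D P}"
    using card_inj_on_le[OF lex_inj lex_image[OF Q] fin] unfolding card_cartesian_product .
qed

text \<open>If \<open>C\<close> is convex for every Conradian cone on \<open>D\<close>, then every
  such cone is lexicographic and the injection becomes a bijection. The factor 2 counts the cones of
  the rank-one quotient.\<close>

lemma card_cones_step:
  assumes tf: "tf_rank_one Q"
    and cv: "\<And>P. conrad_cone G D P \<Longrightarrow> convex_in G D P C"
  shows "card {P. conrad_cone G D P} = 2 * card {P. conrad_cone G C P}"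
proof -
  have Q: "comm_group Q" using tf_rank_oneD(1)[OF tf] .
  have "(\<lambda>(P, R). P \<union> lift R) ` lex_pairs = {P. conrad_cone G D P}"
  proof (rule subset_antisym[OF lex_image[OF Q]], rule subsetI)
    fix P assume "P \<in> {P. conrad_cone G D P}"
    hence P: "conrad_cone G D P" by simp
    interpret P: conrad_group G D P using conrad_groupI[OF subgroup_D P] .
    note R = quotient_cone[OF P.cone cv[OF P]]
    have "(P \<inter> C, proj ` (P - C)) \<in> lex_pairs"
      using P.restrict_conrad_cone[OF subgroup_C C_D] R(1) by blast
    moreover have "P = (\<lambda>(P, R). P \<union> lift R) (P \<inter> C, proj ` (P - C))"
      by (simp only: prod.case R(2)) blast
    ultimately show "P \<in> (\<lambda>(P, R). P \<union> lift R) ` lex_pairs" by (rule rev_image_eqI)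
  qed
  hence "card {P. conrad_cone G D P} = card lex_pairs" using card_image[OF lex_inj] by simp
  thus ?thesis using tf_rank_one_card_cones[OF tf] by (simp add: card_cartesian_product)
qed

end

section \<open>Chains with arbitrary top: convexity, number of cones, uniqueness\<close>

definition rational_chain :: "('a, 'b) monoid_scheme \<Rightarrow> (nat \<Rightarrow> 'a set) \<Rightarrow> nat \<Rightarrow> bool" where
  "rational_chain G S n \<longleftrightarrow> S 0 = {\<one>\<^bsub>G\<^esub>} \<and> (\<forall>i\<le>n. subgroup (S i) G) \<and>
     (\<forall>i<n. S i \<lhd> G\<lparr>carrier := S (Suc i)\<rparr> \<and> tf_rank_one (G\<lparr>carrier := S (Suc i)\<rparr> Mod S i))"

text \<open>The top term is left open, so that initial segments are again chains. Two-step normality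
  is included because the negated \<open>comm_group\<close> could otherwise hold merely since the
  quotient is not a group.\<close>

definition nonabelian_chain :: "('a, 'b) monoid_scheme \<Rightarrow> (nat \<Rightarrow> 'a set) \<Rightarrow> nat \<Rightarrow> bool" where
  "nonabelian_chain G S n \<longleftrightarrow> rational_chain G S n \<and>
     (\<forall>i. i + 2 \<le> n \<longrightarrow> S i \<lhd> G\<lparr>carrier := S (i + 2)\<rparr> \<and>
        \<not> comm_group (G\<lparr>carrier := S (i + 2)\<rparr> Mod S i))"

context group
begin

lemma rational_chainD:
  assumes "rational_chain G S n"
  shows "S 0 = {\<one>}" "\<And>i. i \<le> n \<Longrightarrow> subgroup (S i) G" "\<And>i. i < n \<Longrightarrow> normal_pair G (S i) (S (Suc i))"
    "\<And>i. i < n \<Longrightarrow> tf_rank_one (G\<lparr>carrier := S (Suc i)\<rparr> Mod S i)"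
    "\<And>i. i < n \<Longrightarrow> S i \<subset> S (Suc i)"
proof -
  show 1: "S 0 = {\<one>}" "\<And>i. i \<le> n \<Longrightarrow> subgroup (S i) G"
    "\<And>i. i < n \<Longrightarrow> tf_rank_one (G\<lparr>carrier := S (Suc i)\<rparr> Mod S i)"
    using assms unfolding rational_chain_def by auto
  show 2: "normal_pair G (S i) (S (Suc i))" if "i < n" for i
    using assms that unfolding rational_chain_def
    by (intro normal_pair.intro normal_pair_axioms.intro is_group) auto
  show "S i \<subset> S (Suc i)" if "i < n" for i
    using normal_pair.C_D[OF 2[OF that]] normal_pair.tf_rank_oneD(2)[OF 2[OF that] 1(3)[OF that]] by blast
qed

lemma rational_chain_le: "rational_chain G S n \<Longrightarrow> m \<le> n \<Longrightarrow> rational_chain G S m"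
  unfolding rational_chain_def by simp

lemma nonabelian_chain_le: "nonabelian_chain G S n \<Longrightarrow> m \<le> n \<Longrightarrow> nonabelian_chain G S m"
  using rational_chain_le[of S n m] unfolding nonabelian_chain_def by simp

lemma rational_chain_SucI:
  assumes "rational_chain G S n" "normal_pair G (S n) H" "tf_rank_one (G\<lparr>carrier := H\<rparr> Mod S n)"
  shows "rational_chain G (S(Suc n := H)) (Suc n)"
  using assms normal_pair.subgroup_D[OF assms(2)] normal_pair.normal_C[OF assms(2)]
  unfolding rational_chain_def by (auto simp: less_Suc_eq le_Suc_eq)

lemma rational_chain_convex_step:
  assumes S: "nonabelian_chain G S (Suc (Suc m))" and P: "conrad_cone G (S (Suc (Suc m))) P"
    and cvB: "convex_in G (S (Suc m)) (P \<inter> S (Suc m)) (S m)"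
  shows "convex_in G (S (Suc (Suc m))) P (S (Suc m))"
proof -
  have chain: "rational_chain G S (Suc (Suc m))" using S unfolding nonabelian_chain_def by blast
  define B M H where BMH: "B = S m" "M = S (Suc m)" "H = S (Suc (Suc m))"
  have BM: "normal_pair G B M" "tf_rank_one (G\<lparr>carrier := M\<rparr> Mod B)" "B \<subset> M"
    using rational_chainD(3-5)[OF chain, of m] unfolding BMH by auto
  have MH: "normal_pair G M H" "tf_rank_one (G\<lparr>carrier := H\<rparr> Mod M)" "M \<subset> H"
    using rational_chainD(3-5)[OF chain, of "Suc m"] unfolding BMH by auto
  have sub: "subgroup M G" "subgroup H G" "subgroup B G"
    using rational_chainD(2)[OF chain] unfolding BMH by auto
  have BH: "normal_pair G B H"
    using S sub(2) unfolding nonabelian_chain_def BMH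
    by (intro normal_pair.intro normal_pair_axioms.intro is_group) auto
  have nonab: "\<not> comm_group (G\<lparr>carrier := H\<rparr> Mod B)"
    using S unfolding nonabelian_chain_def BMH by auto
  interpret P: conrad_group G H P using conrad_groupI[OF sub(2)] P unfolding BMH by blast
  interpret PM: cone_group G M "P \<inter> M" using P.restrict_cone[OF sub(1)] MH(3) by blast
  interpret M: subgroup M G by (rule sub(1))
  interpret B: subgroup B G by (rule sub(3))
  have B: "PM.convex B" using cvB unfolding BMH .
  obtain h where h: "h \<in> P" "h \<in> M" "h \<notin> B"
  proof -
    obtain x where x: "x \<in> M" "x \<notin> B" using BM(3) by blast
    hence "inv x \<notin> B" using B.m_inv_closed[of "inv x"] by auto
    moreover have "x \<in> P \<or> inv x \<in> P" using PM.P_total[OF x(1)] x(2) by auto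
    ultimately show ?thesis using that[of x] that[of "inv x"] x by blast
  qed
  \<comment> \<open>The jump at an element of \<open>M\<close> outside \<open>B\<close>. Rank one of
    M/B ties it to the chain: if \<open>D\<close> met \<open>M\<close> beyond \<open>B\<close>, it
    would absorb \<open>M\<close> and thus h; and \<open>E\<close>, which contains h, absorbs
    \<open>M\<close>.\<close>
  define E D where ED: "E = P.arch h" "D = P.low h"
  have E: "P.convex E" "h \<in> E" using P.convex_arch[OF h(1)] P.arch_self[OF h(1)] unfolding ED by auto
  have D: "P.convex D" "h \<notin> D" using P.convex_low[OF h(1)] P.low_notin unfolding ED by auto
  have MleH: "M \<subseteq> H" using MH(3) by blast
  have DM: "PM.convex (D \<inter> M)" and EM: "PM.convex (E \<inter> M)"
    using P.convex_restrict[OF D(1) sub(1) MleH] P.convex_restrict[OF E(1) sub(1) MleH] by auto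
  have DB: "D \<inter> M \<subseteq> B"
  proof (rule ccontr)
    assume *: "\<not> D \<inter> M \<subseteq> B"
    then obtain w where w: "w \<in> D \<inter> M" "w \<notin> B" by blast
    have "B \<subseteq> D \<inter> M" using PM.convex_chain[OF DM B] * by blast
    hence "M \<subseteq> D \<inter> M" using PM.rank_one_absorb[OF BM(1,2) DM subset_refl _ w(1) _ w(2)] w(1) by blast
    thus False using h D(2) by blast
  qed
  have ME: "M \<subseteq> E"
  proof -
    have hE: "h \<in> E \<inter> M" using h E by blast
    hence "B \<subseteq> E \<inter> M" using PM.convex_chain[OF EM B] h(3) by blast
    thus ?thesis using PM.rank_one_absorb[OF BM(1,2) EM subset_refl _ hE h(2,3)] by blast
  qed
  have "P.convex M"
  proof (rule ccontr)
    assume "\<not> P.convex M"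
    then obtain g c where gc: "g \<in> P" "c \<in> M" "inv g \<otimes> c \<in> P" "g \<notin> M"
      unfolding convex_in_def using sub(1) MleH by blast
    have "g \<in> E" using P.convexD(3)[OF E(1) gc(1)] gc(2,3) ME unfolding P.lt_def by blast
    \<comment> \<open>The convex \<open>E\<close> contains \<open>M\<close> and the element g
      outside it, so rank one of H/M makes it absorb \<open>H\<close>.\<close>
    hence HE: "H \<subseteq> E"
      using P.rank_one_absorb[OF MH(1,2) E(1) subset_refl ME _ _ gc(4)] P.P_H[OF gc(1)] by blast
    interpret N: normal_pair G D E using P.jump_normal[OF h(1)] unfolding ED .
    have NE: "comm_group N.Q" using P.jump_comm_group[OF h(1)] unfolding ED .
    interpret MH: normal_pair G M H by (rule MH(1))
    interpret BH: normal_pair G B H by (rule BH)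
    \<comment> \<open>Commutators of \<open>H\<close> lie in \<open>D\<close> because E/D is abelian
      and in \<open>M\<close> because H/M is, hence in \<open>B\<close>.\<close>
    have "x \<otimes> y \<otimes> inv (y \<otimes> x) \<in> B" if xy: "x \<in> H" "y \<in> H" for x y
    proof -
      have "x \<otimes> y \<otimes> inv (y \<otimes> x) \<in> D" using NE xy HE unfolding N.comm_group_Q_iff by blast
      moreover have "x \<otimes> y \<otimes> inv (y \<otimes> x) \<in> M"
        using MH.tf_rank_oneD(1)[OF MH(2)] xy unfolding MH.comm_group_Q_iff by blast
      ultimately show ?thesis using DB by blast
    qed
    thus False using nonab unfolding BH.comm_group_Q_iff by blast
  qed
  thus ?thesis unfolding BMH .
qed

text \<open>The restricted cone on \<open>S n\<close> takes care of the lower terms by induction.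
  Convexity of \<open>S n\<close> in the next term is the real step, and transitivity of convexity
  joins the two.\<close>

lemma nonabelian_chain_convex:
  "nonabelian_chain G S n \<Longrightarrow> conrad_cone G (S n) P \<Longrightarrow> k \<le> n \<Longrightarrow> convex_in G (S n) P (S k)"
proof (induction n arbitrary: P k)
  case 0
  have "subgroup (S 0) G" using rational_chainD(2)[of S 0 0] 0 unfolding nonabelian_chain_def by blast
  then interpret conrad_group G "S 0" P using conrad_groupI 0 by blast
  show ?case using convex_H 0 by simp
next
  case (Suc n)
  have chain: "rational_chain G S (Suc n)" using Suc unfolding nonabelian_chain_def by blast
  have sub: "subgroup (S n) G" "subgroup (S (Suc n)) G" "S n \<subseteq> S (Suc n)"
    using rational_chainD(2,5)[OF chain] by auto
  interpret conrad_group G "S (Suc n)" P using conrad_groupI sub(2) Suc.prems by blast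
  have IH: "convex_in G (S n) (P \<inter> S n) (S k)" if "k \<le> n" for k
    using Suc.IH[OF nonabelian_chain_le[OF Suc.prems(1)] restrict_conrad_cone[OF sub(1,3)] that] by simp
  have top: "convex (S n)"
  proof (cases n)
    case 0 thus ?thesis using rational_chainD(1)[OF chain] convex_one by simp
  next
    case (Suc m)
    thus ?thesis using rational_chain_convex_step[of S m P] Suc.prems IH[of m] by simp
  qed
  show ?case
  proof (cases "k = Suc n")
    case True thus ?thesis using convex_H by simp
  next
    case False
    thus ?thesis using convex_trans[OF top IH] Suc.prems(3) by simp
  qed
qed

lemma conrad_cone_one: "conrad_cone G {\<one>} P \<longleftrightarrow> P = {}"
  unfolding conrad_cone_def pos_cone_def by auto

lemma card_conrad_cones:
  "nonabelian_chain G S n \<Longrightarrow> card {P. conrad_cone G (S n) P} = 2 ^ n"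
proof (induction n)
  case 0
  hence "S 0 = {\<one>}" unfolding nonabelian_chain_def rational_chain_def by blast
  thus ?case by (simp add: conrad_cone_one)
next
  case (Suc n)
  have chain: "rational_chain G S (Suc n)" using Suc unfolding nonabelian_chain_def by blast
  interpret N: normal_pair G "S n" "S (Suc n)" using rational_chainD(3)[OF chain] by simp
  have "card {P. conrad_cone G (S (Suc n)) P} = 2 * card {P. conrad_cone G (S n) P}"
  proof (rule N.card_cones_step)
    show "tf_rank_one N.Q" using rational_chainD(4)[OF chain] by simp
    show "convex_in G (S (Suc n)) P (S n)" if "conrad_cone G (S (Suc n)) P" for P
      using nonabelian_chain_convex[OF Suc.prems that] by simp
  qed
  thus ?case using Suc.IH nonabelian_chain_le[OF Suc.prems, of n] by simp
qed

text \<open>Cones on the rank-one quotients are stacked lexicographically, which keeps all lower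
  terms convex. This supplies the cone adapted to a competing series.\<close>

lemma rational_chain_cone:
  "rational_chain G T m \<Longrightarrow> \<exists>P. conrad_cone G (T m) P \<and> (\<forall>k\<le>m. convex_in G (T m) P (T k))"
proof (induction m)
  case 0
  have T: "T 0 = {\<one>}" using rational_chainD(1)[OF 0] .
  hence "conrad_cone G (T 0) {}" by (simp add: conrad_cone_one)
  moreover have "convex_in G (T 0) {} (T 0)" using triv_subgroup unfolding convex_in_def T by simp
  ultimately show ?case by auto
next
  case (Suc m)
  obtain P where P: "conrad_cone G (T m) P" "\<And>k. k \<le> m \<Longrightarrow> convex_in G (T m) P (T k)"
    using Suc.IH rational_chain_le[OF Suc.prems, of m] by auto
  interpret N: normal_pair G "T m" "T (Suc m)" using rational_chainD(3)[OF Suc.prems] by simp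
  have tf: "tf_rank_one N.Q" using rational_chainD(4)[OF Suc.prems] by simp
  have "{R. pos_cone N.Q (carrier N.Q) R} \<noteq> {}" using tf_rank_one_card_cones[OF tf] by force
  then obtain R where R: "pos_cone N.Q (carrier N.Q) R" by blast
  define P' where "P' = P \<union> N.lift R"
  have P': "conrad_cone G (T (Suc m)) P'"
    unfolding P'_def using N.lift_lex[OF P(1) N.tf_rank_oneD(1)[OF tf] R] .
  interpret P': conrad_group G "T (Suc m)" P' using conrad_groupI[OF N.subgroup_D P'] .
  have "pos_cone G (T m) P" using P(1) unfolding conrad_cone_def by blast
  hence top: "P'.convex (T m)" unfolding P'_def using N.convex_lift_lex R by blast
  have "P' \<inter> T m = P"
    using N.lift_disjoint[OF R] P(1) unfolding P'_def conrad_cone_def pos_cone_def by blast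
  hence "P'.convex (T k)" if "k \<le> m" for k
    using P'.convex_trans[OF top] P(2)[OF that] by simp
  hence "P'.convex (T k)" if "k \<le> Suc m" for k
    using P'.convex_H that by (cases "k = Suc m") auto
  thus ?case using P' by blast
qed

lemma rational_chain_top_trivial:
  assumes "rational_chain G T m" "T m = {\<one>}"
  shows "m = 0"
proof (rule ccontr)
  assume "m \<noteq> 0"
  then obtain k where k: "m = Suc k" using not0_implies_Suc by blast
  hence "T k \<subset> {\<one>}" using rational_chainD(5)[OF assms(1), of k] assms(2) by simp
  moreover have "\<one> \<in> T k" using rational_chainD(2)[OF assms(1), of k] k subgroup.one_closed by auto
  ultimately show False by blast
qed

text \<open>Take a cone for which the terms of \<open>T\<close> are convex. Then \<open>T k\<close>
  and \<open>S n\<close> are convex for the same cone, hence comparable. The larger one, if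
  different, would by rank one be the whole top term, against strictness of the chains. So they
  agree, and the induction descends.\<close>

lemma nonabelian_chain_unique:
  "\<lbrakk>nonabelian_chain G S n; rational_chain G T m; T m = S n\<rbrakk> \<Longrightarrow> m = n \<and> (\<forall>i\<le>n. T i = S i)"
proof (induction n arbitrary: m)
  case 0
  hence "S 0 = {\<one>}" unfolding nonabelian_chain_def rational_chain_def by blast
  thus ?case using rational_chain_top_trivial[OF 0(2)] 0(3) by simp
next
  case (Suc n)
  have chain: "rational_chain G S (Suc n)" using Suc.prems unfolding nonabelian_chain_def by blast
  have "S (Suc n) \<noteq> {\<one>}" using rational_chain_top_trivial[OF chain] by blast
  hence "m \<noteq> 0" using rational_chainD(1)[OF Suc.prems(2)] Suc.prems(3) by metis
  then obtain k where k: "m = Suc k" using not0_implies_Suc by blast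
  obtain P where P: "conrad_cone G (T m) P" "convex_in G (T m) P (T k)"
    using rational_chain_cone[OF Suc.prems(2)] k by auto
  have cS: "convex_in G (T m) P (S n)"
    using nonabelian_chain_convex[OF Suc.prems(1), of P n] P(1) Suc.prems(3) by simp
  interpret conrad_group G "T m" P
    using conrad_groupI[OF _ P(1)] rational_chainD(2)[OF Suc.prems(2)] by blast
  have T: "normal_pair G (T k) (T m)" "tf_rank_one (G\<lparr>carrier := T m\<rparr> Mod T k)" "T k \<subset> T m"
    using rational_chainD(3-5)[OF Suc.prems(2), of k] k by auto
  have S: "normal_pair G (S n) (T m)" "tf_rank_one (G\<lparr>carrier := T m\<rparr> Mod S n)" "S n \<subset> T m"
    using rational_chainD(3-5)[OF chain, of n] Suc.prems(3) by auto
  have "T k = S n"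
  proof (rule ccontr)
    assume ne: "T k \<noteq> S n"
    show False
    proof (cases "T k \<subseteq> S n")
      case True
      then obtain w where "w \<in> S n" "w \<notin> T k" using ne by blast
      thus False using rank_one_absorb[OF T(1,2) cS subset_refl True, of w] S(3) by blast
    next
      case False
      hence "S n \<subseteq> T k" using convex_chain[OF P(2) cS] by blast
      moreover obtain w where "w \<in> T k" "w \<notin> S n" using False by blast
      ultimately show False using rank_one_absorb[OF S(1,2) P(2) subset_refl, of w] T(3) by blast
    qed
  qed
  hence "k = n \<and> (\<forall>i\<le>n. T i = S i)"
    using Suc.IH[OF nonabelian_chain_le[OF Suc.prems(1)] rational_chain_le[OF Suc.prems(2)], of k] k by simp
  thus ?case using k Suc.prems(3) le_Suc_eq by auto
qed

end

section \<open>Transport of chains along injective endomorphisms, and normality\<close>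

context normal_pair
begin

text \<open>Conditions on elements are carried over by an injective homomorphism directly, so no
  isomorphism between quotient groups has to be constructed.\<close>

lemma tf_rank_one_iff:
  "tf_rank_one Q \<longleftrightarrow> (\<forall>x\<in>D. \<forall>y\<in>D. x \<otimes> y \<otimes> inv (y \<otimes> x) \<in> C) \<and> C \<noteq> D \<and>
     (\<forall>x\<in>D. \<forall>k::int. k \<noteq> 0 \<longrightarrow> x [^] k \<in> C \<longrightarrow> x \<in> C) \<and>
     (\<forall>x\<in>D. \<forall>y\<in>D. \<exists>(a::int) (b::int). (a \<noteq> 0 \<or> b \<noteq> 0) \<and> x [^] a \<otimes> y [^] b \<in> C)"
  (is "_ \<longleftrightarrow> ?comm \<and> ?ne \<and> ?tf \<and> ?rk")
proof
  assume "tf_rank_one Q"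
  note * = tf_rank_oneD[OF this]
  have ?comm using *(1) unfolding comm_group_Q_iff .
  moreover have ?ne using *(2) .
  moreover have ?tf using *(4) by blast
  moreover have ?rk using *(3) by blast
  ultimately show "?comm \<and> ?ne \<and> ?tf \<and> ?rk" by blast
next
  assume *: "?comm \<and> ?ne \<and> ?tf \<and> ?rk"
  hence comm: "comm_group Q" and ne: "C \<noteq> D" and tf: "?tf" and rk: "?rk"
    unfolding comm_group_Q_iff by auto
  show "tf_rank_one Q"
    unfolding tf_rank_one_def
  proof (intro conjI ballI allI impI)
    show "comm_group Q" by fact
    obtain d where d: "d \<in> D" "d \<notin> C" using ne C_D by blast
    hence "proj d \<in> carrier Q" "proj d \<noteq> \<one>\<^bsub>Q\<^esub>" using carrier_Q proj_one_iff by auto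
    thus "carrier Q \<noteq> {\<one>\<^bsub>Q\<^esub>}" by blast
  next
    fix u and k :: int assume u: "u \<in> carrier Q" and k: "k \<noteq> 0 \<and> u [^]\<^bsub>Q\<^esub> k = \<one>\<^bsub>Q\<^esub>"
    obtain x where x: "x \<in> D" "u = proj x" using u carrier_Q by auto
    have "proj (x [^] k) = \<one>\<^bsub>Q\<^esub>" using k x proj_int_pow by simp
    hence "x [^] k \<in> C" using proj_one_iff D_int_pow[OF x(1)] by blast
    hence "x \<in> C" using tf x(1) k by blast
    thus "u = \<one>\<^bsub>Q\<^esub>" using proj_one_iff x by simp
  next
    fix u v assume u: "u \<in> carrier Q" and v: "v \<in> carrier Q"
    obtain x where x: "x \<in> D" "u = proj x" using u carrier_Q by auto
    obtain y where y: "y \<in> D" "v = proj y" using v carrier_Q by auto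
    obtain a b :: int where ab: "a \<noteq> 0 \<or> b \<noteq> 0" "x [^] a \<otimes> y [^] b \<in> C" using rk x(1) y(1) by blast
    have d: "x [^] a \<in> D" "y [^] b \<in> D" using D_int_pow x(1) y(1) by auto
    have "proj (x [^] a \<otimes> y [^] b) = \<one>\<^bsub>Q\<^esub>" using proj_one_iff ab(2) C_D by blast
    hence "u [^]\<^bsub>Q\<^esub> a \<otimes>\<^bsub>Q\<^esub> v [^]\<^bsub>Q\<^esub> b = \<one>\<^bsub>Q\<^esub>"
      using proj_mult[OF d] x y proj_int_pow by simp
    thus "\<exists>(a::int) (b::int). (a \<noteq> 0 \<or> b \<noteq> 0) \<and> u [^]\<^bsub>Q\<^esub> a \<otimes>\<^bsub>Q\<^esub> v [^]\<^bsub>Q\<^esub> b = \<one>\<^bsub>Q\<^esub>"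
      using ab(1) by blast
  qed
qed

end

lemma (in normal_pair) inj_hom_image:
  assumes hom: "group_hom G G \<phi>" and inj: "inj_on \<phi> (carrier G)"
  shows "normal_pair G (\<phi> ` C) (\<phi> ` D)"
    "tf_rank_one Q \<Longrightarrow> tf_rank_one (G\<lparr>carrier := \<phi> ` D\<rparr> Mod (\<phi> ` C))"
proof -
  interpret \<phi>: group_hom G G \<phi> by fact
  have mem: "\<phi> x \<in> \<phi> ` C \<longleftrightarrow> x \<in> C" if "x \<in> D" for x
    using inj_on_image_mem_iff[OF inj, of x C] that C.subset by auto
  have hconj: "\<phi> x \<otimes> \<phi> c \<otimes> inv (\<phi> x) = \<phi> (x \<otimes> c \<otimes> inv x)" if "x \<in> D" "c \<in> D" for x c
    using that by simp
  show np: "normal_pair G (\<phi> ` C) (\<phi> ` D)"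
  proof (rule normal_pairI)
    show "subgroup (\<phi> ` C) G" "subgroup (\<phi> ` D) G"
      using \<phi>.subgroup_img_is_subgroup subgroup_C subgroup_D by auto
    show "\<phi> ` C \<subseteq> \<phi> ` D" using C_D by blast
    fix u v assume "u \<in> \<phi> ` D" "v \<in> \<phi> ` C"
    then obtain x c where xc: "x \<in> D" "c \<in> C" "u = \<phi> x" "v = \<phi> c" by blast
    have "x \<otimes> c \<otimes> inv x \<in> C" using conj_C[of "inv x" c] xc by simp
    moreover have "c \<in> D" using xc(2) C_D by blast
    ultimately show "u \<otimes> v \<otimes> inv u \<in> \<phi> ` C" unfolding xc(3,4) using hconj[OF xc(1)] by (metis imageI)
  qed
  assume tf: "tf_rank_one Q"
  note * = tf[unfolded tf_rank_one_iff]
  interpret N: normal_pair G "\<phi> ` C" "\<phi> ` D" by (rule np)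
  have pow: "\<phi> x [^] k = \<phi> (x [^] k)" if "x \<in> D" for x and k :: int
    using \<phi>.hom_int_pow[of x k] that by simp
  show "tf_rank_one N.Q"
    unfolding N.tf_rank_one_iff
  proof (intro conjI ballI allI impI)
    show "\<phi> ` C \<noteq> \<phi> ` D"
    proof
      assume "\<phi> ` C = \<phi> ` D"
      hence "D \<subseteq> C" using mem by blast
      thus False using * C_D by blast
    qed
  next
    fix u v assume "u \<in> \<phi> ` D" "v \<in> \<phi> ` D"
    then obtain x y where xy: "x \<in> D" "y \<in> D" "u = \<phi> x" "v = \<phi> y" by blast
    have "u \<otimes> v \<otimes> inv (v \<otimes> u) = \<phi> (x \<otimes> y \<otimes> inv (y \<otimes> x))" using xy by simp
    moreover have "x \<otimes> y \<otimes> inv (y \<otimes> x) \<in> C" using * xy by blast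
    ultimately show "u \<otimes> v \<otimes> inv (v \<otimes> u) \<in> \<phi> ` C" by (metis imageI)
    obtain a b :: int where ab: "a \<noteq> 0 \<or> b \<noteq> 0" "x [^] a \<otimes> y [^] b \<in> C" using * xy(1,2) by blast
    have "u [^] a \<otimes> v [^] b = \<phi> (x [^] a \<otimes> y [^] b)" using xy pow by simp
    thus "\<exists>(a::int) (b::int). (a \<noteq> 0 \<or> b \<noteq> 0) \<and> u [^] a \<otimes> v [^] b \<in> \<phi> ` C"
      using ab by (metis imageI)
  next
    fix u and k :: int assume u: "u \<in> \<phi> ` D" and k: "k \<noteq> 0" "u [^] k \<in> \<phi> ` C"
    then obtain x where x: "x \<in> D" "u = \<phi> x" by blast
    have "x [^] k \<in> C" using k(2) x pow mem[OF D_int_pow[OF x(1)]] by simp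
    hence "x \<in> C" using * k(1) x(1) by blast
    thus "u \<in> \<phi> ` C" using x(2) by blast
  qed
qed

lemma (in group) rational_chain_hom_image:
  assumes hom: "group_hom G G \<phi>" and inj: "inj_on \<phi> (carrier G)" and S: "rational_chain G S n"
  shows "rational_chain G (\<lambda>i. \<phi> ` S i) n"
proof -
  interpret \<phi>: group_hom G G \<phi> by fact
  have "\<phi> ` S i \<lhd> G\<lparr>carrier := \<phi> ` S (Suc i)\<rparr> \<and> tf_rank_one (G\<lparr>carrier := \<phi> ` S (Suc i)\<rparr> Mod \<phi> ` S i)"
    if i: "i < n" for i
  proof -
    interpret normal_pair G "S i" "S (Suc i)" using rational_chainD(3)[OF S i] .
    show ?thesis
      using normal_pair.normal_C[OF inj_hom_image(1)[OF hom inj]]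
        inj_hom_image(2)[OF hom inj rational_chainD(4)[OF S i]] by blast
  qed
  moreover have "subgroup (\<phi> ` S i) G" if "i \<le> n" for i
    using \<phi>.subgroup_img_is_subgroup rational_chainD(2)[OF S that] .
  ultimately show ?thesis unfolding rational_chain_def using rational_chainD(1)[OF S] by simp
qed

lemma (in group) conj_hom:
  assumes "x \<in> carrier G"
  shows "group_hom G G (\<lambda>y. x \<otimes> y \<otimes> inv x)" "inj_on (\<lambda>y. x \<otimes> y \<otimes> inv x) (carrier G)"
proof -
  show "group_hom G G (\<lambda>y. x \<otimes> y \<otimes> inv x)"
    by (intro group_hom.intro group_hom_axioms.intro homI is_group)
      (use assms in \<open>simp_all add: m_assoc\<close>)
  show "inj_on (\<lambda>y. x \<otimes> y \<otimes> inv x) (carrier G)"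
    by (rule inj_onI) (use assms in simp)
qed

text \<open>Conjugation by an element of \<open>H\<close> maps \<open>S n\<close> onto itself and
  the chain to a rational chain with the same top, so by uniqueness it fixes every term. This makes
  the two-step quotients groups when a new top is added.\<close>

lemma (in group) nonabelian_chain_normal:
  assumes S: "nonabelian_chain G S n" and top: "normal_pair G (S n) H" and i: "i \<le> n"
  shows "normal_pair G (S i) H"
proof (rule normal_pairI)
  interpret N: normal_pair G "S n" H by fact
  have chain: "rational_chain G S n" using S unfolding nonabelian_chain_def by blast
  show "subgroup (S i) G" using rational_chainD(2)[OF chain i] .
  show "subgroup H G" by (rule N.subgroup_D)
  have conj: "(\<lambda>y. x \<otimes> y \<otimes> inv x) ` S j = S j" if x: "x \<in> H" and j: "j \<le> n" for x j
  proof -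
    have xC: "x \<in> carrier G" using x by simp
    have "(\<lambda>y. x \<otimes> y \<otimes> inv x) ` S n = S n"
    proof (rule subset_antisym; rule subsetI)
      fix z assume "z \<in> (\<lambda>y. x \<otimes> y \<otimes> inv x) ` S n"
      thus "z \<in> S n" using N.conj_C[of "inv x"] x by auto
    next
      fix z assume z: "z \<in> S n"
      have "inv x \<otimes> z \<otimes> x \<in> S n" using N.conj_C[OF x z] .
      moreover have "z = x \<otimes> (inv x \<otimes> z \<otimes> x) \<otimes> inv x" using z xC by (simp add: m_assoc)
      ultimately show "z \<in> (\<lambda>y. x \<otimes> y \<otimes> inv x) ` S n" by blast
    qed
    thus ?thesis
      using nonabelian_chain_unique[OF S rational_chain_hom_image[OF conj_hom[OF xC] chain]] j by blast
  qed
  show "x \<otimes> c \<otimes> inv x \<in> S i" if "x \<in> H" "c \<in> S i" for x c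
    using conj[OF that(1) i] that(2) by blast
  \<comment> \<open>Any cone will do: convexity of \<open>S i\<close> includes its inclusion in
    \<open>S n\<close>.\<close>
  interpret conrad_group G "S n" "SOME P. conrad_cone G (S n) P"
    using conrad_groupI[OF N.subgroup_C] rational_chain_cone[OF chain] someI_ex[of "conrad_cone G (S n)"] by blast
  show "S i \<subseteq> H"
    using convexD(2)[OF nonabelian_chain_convex[OF S conrad_cone_P i]] N.C_D by blast
qed

subsection \<open>Groups with finitely many Conradian orderings\<close>

context conrad_group
begin

text \<open>Signs are reversed between \<open>low g\<close> and \<open>arch g\<close> and kept below
  and above: reverse the quotient order, lift it lexicographically to \<open>arch g\<close>, then
  apply \<open>surgery\<close>. The set P - F records the jump.\<close>

lemma flip_jump:
  assumes g: "g \<in> P"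
  shows "\<exists>F. conrad_cone G H F \<and> P - F = P \<inter> arch g - low g"
proof -
  interpret N: normal_pair G "low g" "arch g" using jump_normal[OF g] .
  interpret Q: comm_group N.Q using jump_comm_group[OF g] .
  let ?R = "N.proj ` (P \<inter> arch g - low g)"
  note R = N.quotient_cone[OF jump_cone[OF g]]
  define R' where "R' = {x \<in> carrier N.Q. inv\<^bsub>N.Q\<^esub> x \<in> ?R}"
  have R': "pos_cone N.Q (carrier N.Q) R'" unfolding R'_def using Q.cone_reverse[OF R(1)] .
  have lowH: "low g \<subseteq> H" using convexD(2)[OF convex_low[OF g]] .
  define F1 where "F1 = P \<inter> low g \<union> N.lift R'"
  have F1: "conrad_cone G (arch g) F1"
    unfolding F1_def using N.lift_lex[OF restrict_conrad_cone[OF N.subgroup_C lowH] Q.comm_group_axioms R'] .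
  define F where "F = F1 \<union> (P - arch g)"
  have F: "conrad_cone G H F" unfolding F_def using surgery[OF convex_arch[OF g] F1] .
  have lift: "x \<notin> P" if "x \<in> N.lift R'" for x
  proof
    assume xP: "x \<in> P"
    have x: "x \<in> arch g" "inv\<^bsub>N.Q\<^esub> (N.proj x) \<in> ?R" using that unfolding N.lift_def R'_def by auto
    hence "inv x \<in> N.lift ?R" using N.proj_inv[OF x(1)] unfolding N.lift_def by simp
    hence "inv x \<in> P" unfolding R(2) by blast
    thus False using P_inv_notin xP by blast
  qed
  have low_arch: "low g \<subseteq> arch g" using low_le_arch[OF g] .
  have "P - F = P \<inter> arch g - low g"
    unfolding F_def F1_def using lift low_arch by blast
  thus ?thesis using F by blast
qed

text \<open>A jump is recovered from its flip F as the \<open>arch\<close> of any element of P - F,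
  so there are at most as many jumps as cones. For a cone F containing \<open>P\<close> the choice
  is arbitrary, which can only enlarge the image.\<close>

lemma finite_jumps:
  assumes "finite {F. conrad_cone G H F}"
  shows "finite (arch ` P)"
proof -
  have "arch ` P \<subseteq> (\<lambda>F. arch (SOME g. g \<in> P - F)) ` {F. conrad_cone G H F}"
  proof
    fix A assume "A \<in> arch ` P"
    then obtain g where g: "g \<in> P" "A = arch g" by blast
    obtain F where F: "conrad_cone G H F" "P - F = P \<inter> arch g - low g" using flip_jump[OF g(1)] by blast
    define h where "h = (SOME g. g \<in> P - F)"
    have "g \<in> P - F" unfolding F(2) using g arch_self low_notin by blast
    hence "h \<in> P - F" unfolding h_def by (rule someI)
    hence h: "h \<in> P" "h \<in> arch g" "h \<notin> low g" unfolding F(2) by auto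
    have "arch h \<subseteq> arch g" using arch_least[OF convex_arch[OF g(1)] h(2,1)] .
    moreover have "g \<in> arch h"
      using low_greatest[OF convex_arch[OF h(1)], of g] arch_self[OF h(1)] h(3) by blast
    hence "arch g \<subseteq> arch h" using arch_least[OF convex_arch[OF h(1)] _ g(1)] by blast
    ultimately have "A = arch h" using g(2) by blast
    thus "A \<in> (\<lambda>F. arch (SOME g. g \<in> P - F)) ` {F. conrad_cone G H F}" unfolding h_def using F(1) by blast
  qed
  thus ?thesis using assms finite_surj by blast
qed

text \<open>Among finitely many subgroups \<open>arch h\<close> one is maximal; being comparable
  with all others it is the largest, so it contains every positive element.\<close>

lemma finite_cones_top:
  assumes fin: "finite {F. conrad_cone G H F}" and ne: "H \<noteq> {\<one>}"
  obtains g where "g \<in> P" "arch g = H"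
proof -
  obtain x where "x \<in> H" "x \<noteq> \<one>" using ne H_one by blast
  hence "P \<noteq> {}" using P_total by blast
  hence "arch ` P \<noteq> {}" by simp
  from finite_has_maximal[OF finite_jumps[OF fin] this]
  obtain A where A: "A \<in> arch ` P" "\<forall>B\<in>arch ` P. A \<subseteq> B \<longrightarrow> A = B" by blast
  obtain g where g: "g \<in> P" "A = arch g" using A(1) by blast
  have le: "arch h \<subseteq> arch g" if h: "h \<in> P" for h
    using convex_chain[OF convex_arch[OF h] convex_arch[OF g(1)]]
  proof
    assume "arch g \<subseteq> arch h"
    thus ?thesis using A(2) h unfolding g(2) by fastforce
  qed
  have "P \<subseteq> arch g" using arch_self le by blast
  hence "H \<subseteq> arch g"
    using subgroup_le_by_P[OF subgroup_H subset_refl convexD(1)[OF convex_arch[OF g(1)]]] by blast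
  thus ?thesis using that[OF g(1)] convexD(2)[OF convex_arch[OF g(1)]] by blast
qed

end

context group
begin

text \<open>The length is not known in advance, so the induction is on the number of cones: the two
  signs on the top quotient leave at most half of them for the lower term.\<close>

lemma finite_cones_chain:
  "\<lbrakk>subgroup H G; conrad_cone G H P; finite {F. conrad_cone G H F}\<rbrakk> \<Longrightarrow>
     \<exists>n S. nonabelian_chain G S n \<and> S n = H"
proof (induction "card {F. conrad_cone G H F}" arbitrary: H P rule: less_induct)
  case less
  interpret conrad_group G H P using conrad_groupI less.prems by blast
  show ?case
  proof (cases "H = {\<one>}")
    case True
    have "nonabelian_chain G (\<lambda>_. H) 0"
      unfolding nonabelian_chain_def rational_chain_def using True subgroup_H by simp
    thus ?thesis by blast
  next
    case False
    obtain g where g: "g \<in> P" "arch g = H" using finite_cones_top[OF less.prems(3) False] .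
    define C where "C = low g"
    interpret N: normal_pair G C H using jump_normal[OF g(1)] unfolding g(2) C_def .
    have Q: "comm_group N.Q" using jump_comm_group[OF g(1)] unfolding g(2) C_def .
    have cvC: "convex C" using convex_low[OF g(1)] unfolding C_def .
    have PC: "conrad_cone G C (P \<inter> C)" using restrict_conrad_cone[OF N.subgroup_C N.C_D] .
    have R: "pos_cone N.Q (carrier N.Q) (N.proj ` (P - C))" using N.quotient_cone(1)[OF cone cvC] .
    note fin = N.finite_card_lex[OF Q less.prems(3) PC R]
    have "N.proj g \<in> carrier N.Q" "N.proj g \<noteq> \<one>\<^bsub>N.Q\<^esub>"
      using P_H[OF g(1)] N.carrier_Q N.proj_one_iff[of g] low_notin[of g] unfolding C_def by auto
    hence tf: "tf_rank_one N.Q" using tf_rank_one_if_finite_cones[OF Q R fin(2)] by blast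
    have "card {F. conrad_cone G C F} > 0" using fin(1) PC card_gt_0_iff by blast
    hence "card {F. conrad_cone G C F} < card {F. conrad_cone G H F}"
      using fin(3) tf_rank_one_card_cones[OF tf] by simp
    from less.hyps[OF this N.subgroup_C PC fin(1)]
    obtain n S where S: "nonabelian_chain G S n" "S n = C" by blast
    have chain: "rational_chain G S n" using S unfolding nonabelian_chain_def by blast
    have top: "normal_pair G (S n) H" unfolding S(2) by (rule N.normal_pair_axioms)
    define S' where "S' = S(Suc n := H)"
    have chain': "rational_chain G S' (Suc n)"
      unfolding S'_def using rational_chain_SucI[OF chain top] tf unfolding S(2) .
    have "S' i \<lhd> G\<lparr>carrier := S' (i + 2)\<rparr> \<and> \<not> comm_group (G\<lparr>carrier := S' (i + 2)\<rparr> Mod S' i)"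
      if i: "i + 2 \<le> Suc n" for i
    proof (cases "i + 2 = Suc n")
      case False
      thus ?thesis using S(1) i unfolding nonabelian_chain_def S'_def by simp
    next
      \<comment> \<open>Only the topmost two-step quotient is new.\<close>
      case True
      hence n: "n = Suc i" by simp
      interpret M: normal_pair G "S i" H using nonabelian_chain_normal[OF S(1) top] n by simp
      have step: "normal_pair G (S i) C" "tf_rank_one (G\<lparr>carrier := C\<rparr> Mod S i)" "S i \<subset> C"
        using rational_chainD(3-5)[OF chain, of i] n S(2) by auto
      interpret MC: normal_pair G "S i" C by (rule step(1))
      \<comment> \<open>An abelian quotient would have finitely many cones and hence rank one. But g
        outside \<open>C\<close> and some h in \<open>C\<close> outside \<open>S i\<close> are
        independent: in a relation g^a h^b in \<open>S i\<close>, a vanishes because H/C is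
        torsion-free, and then b because the quotient by \<open>S i\<close> is.\<close>
      have "\<not> comm_group M.Q"
      proof
        assume MQ: "comm_group M.Q"
        have "convex_in G C (P \<inter> C) (S i)"
          using nonabelian_chain_convex[OF S(1), of "P \<inter> C" i] PC S(2) n by simp
        hence cv: "convex (S i)" using convex_trans[OF cvC] by blast
        have RM: "pos_cone M.Q (carrier M.Q) (M.proj ` (P - S i))" using M.quotient_cone(1)[OF cone cv] .
        have PM: "conrad_cone G (S i) (P \<inter> S i)" using restrict_conrad_cone[OF M.subgroup_C M.C_D] .
        have finM: "finite {R. pos_cone M.Q (carrier M.Q) R}"
          using M.finite_card_lex(2)[OF MQ less.prems(3) PM RM] .
        have gS: "g \<in> H" "g \<notin> C" using P_H[OF g(1)] low_notin unfolding C_def by auto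
        hence "M.proj g \<in> carrier M.Q" "M.proj g \<noteq> \<one>\<^bsub>M.Q\<^esub>"
          using M.carrier_Q M.proj_one_iff[of g] step(3) by auto
        hence tfM: "tf_rank_one M.Q" using tf_rank_one_if_finite_cones[OF MQ RM finM] by blast
        obtain h where h: "h \<in> C" "h \<notin> S i" using step(3) by blast
        hence hH: "h \<in> H" using N.C_D by blast
        obtain a b :: int where ab: "a \<noteq> 0 \<or> b \<noteq> 0" "g [^] a \<otimes> h [^] b \<in> S i"
          using M.tf_rank_oneD(3)[OF tfM gS(1) hH] by blast
        have hb: "h [^] b \<in> C" using MC.D_int_pow[OF h(1)] .
        have "g [^] a \<otimes> h [^] b \<otimes> inv (h [^] b) \<in> C" using ab(2) step(3) hb by blast
        hence "g [^] a \<in> C" using gS hH by (simp add: m_assoc)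
        hence "a = 0" using N.tf_rank_oneD(4)[OF tf gS(1)] gS(2) by blast
        hence "b \<noteq> 0" "h [^] b \<in> S i" using ab hH by auto
        thus False using M.tf_rank_oneD(4)[OF tfM hH] h(2) by blast
      qed
      thus ?thesis using M.normal_C unfolding S'_def n by simp
    qed
    hence "nonabelian_chain G S' (Suc n)" using chain' unfolding nonabelian_chain_def by blast
    moreover have "S' (Suc n) = H" unfolding S'_def by simp
    ultimately show ?thesis by blast
  qed
qed

subsection \<open>Orderings and positive cones\<close>

definition positives :: "'a rel \<Rightarrow> 'a set" where
  "positives R = {x \<in> carrier G. strictly_less R \<one> x}"

text \<open>Pairs are confined to the carrier, as \<open>left_ordering\<close> demands; this makes
  the correspondence with cones a bijection, so that counting orderings is counting cones.\<close>

definition cone_order :: "'a set \<Rightarrow> 'a rel" where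
  "cone_order P = {(x, y). x \<in> carrier G \<and> y \<in> carrier G \<and> (x = y \<or> inv x \<otimes> y \<in> P)}"

lemma left_ordering_shift:
  assumes R: "left_ordering G R" and x: "x \<in> carrier G" "y \<in> carrier G" "z \<in> carrier G"
  shows "(z \<otimes> x, z \<otimes> y) \<in> R \<longleftrightarrow> (x, y) \<in> R"
proof
  have inv: "(f \<otimes> u, f \<otimes> v) \<in> R"
    if "(u, v) \<in> R" "f \<in> carrier G" "u \<in> carrier G" "v \<in> carrier G" for f u v
    using R that unfolding left_ordering_def by blast
  show "(z \<otimes> x, z \<otimes> y) \<in> R" if "(x, y) \<in> R" using inv[OF that] x by blast
  show "(x, y) \<in> R" if "(z \<otimes> x, z \<otimes> y) \<in> R" using inv[OF that, of "inv z"] x by simp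
qed

lemma strictly_less_iff_positive:
  assumes R: "left_ordering G R" and x: "x \<in> carrier G" "y \<in> carrier G"
  shows "strictly_less R x y \<longleftrightarrow> inv x \<otimes> y \<in> positives R"
proof -
  have "(x, y) \<in> R \<longleftrightarrow> (\<one>, inv x \<otimes> y) \<in> R"
    using left_ordering_shift[OF R, of x y "inv x"] x by simp
  moreover have "x = y \<longleftrightarrow> \<one> = inv x \<otimes> y" using x by (metis inv_closed l_inv l_cancel)
  ultimately show ?thesis unfolding positives_def strictly_less_def using x by simp
qed

lemma conrad_cone_positives:
  assumes "C_ordering G R"
  shows "conrad_cone G (carrier G) (positives R)"
proof -
  have R: "left_ordering G R" using assms unfolding C_ordering_def by blast
  note less = strictly_less_iff_positive[OF R]
  have trans: "(x, z) \<in> R" if "(x, y) \<in> R" "(y, z) \<in> R" "x \<in> carrier G" "y \<in> carrier G" "z \<in> carrier G" for x y z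
    using R that unfolding left_ordering_def by blast
  have antisym: "x = y" if "(x, y) \<in> R" "(y, x) \<in> R" "x \<in> carrier G" "y \<in> carrier G" for x y
    using R that unfolding left_ordering_def by blast
  have total: "(x, y) \<in> R \<or> (y, x) \<in> R" if "x \<in> carrier G" "y \<in> carrier G" for x y
    using R that unfolding left_ordering_def by blast
  have mult: "x \<otimes> y \<in> positives R" if xy: "x \<in> positives R" "y \<in> positives R" for x y
  proof -
    have c: "x \<in> carrier G" "y \<in> carrier G" "(\<one>, x) \<in> R" "x \<noteq> \<one>" "(\<one>, y) \<in> R"
      using xy unfolding positives_def strictly_less_def by auto
    have xxy: "(x, x \<otimes> y) \<in> R" using left_ordering_shift[OF R, of \<one> y x] c by simp
    hence "(\<one>, x \<otimes> y) \<in> R" using trans[OF c(3) xxy] c by simp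
    moreover have "x \<otimes> y \<noteq> \<one>" using antisym[of \<one> x] xxy c by auto
    ultimately show ?thesis unfolding positives_def strictly_less_def using c by auto
  qed
  have "x = \<one> \<or> x \<in> positives R \<or> inv x \<in> positives R" if x: "x \<in> carrier G" for x
    using total[OF x one_closed] less[of x \<one>] x unfolding positives_def strictly_less_def by auto
  moreover have "\<exists>n::nat. inv g \<otimes> f \<otimes> g [^] n \<in> positives R"
    if fg: "f \<in> positives R" "g \<in> positives R" for f g
  proof -
    have c: "f \<in> carrier G" "g \<in> carrier G" using fg unfolding positives_def by auto
    obtain n :: nat where "strictly_less R g (f \<otimes> g [^] n)"
      using assms fg unfolding C_ordering_def positives_def by blast
    thus ?thesis using less[of g "f \<otimes> g [^] n"] c by (auto simp: m_assoc)
  qed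
  ultimately show ?thesis
    unfolding conrad_cone_def pos_cone_def using mult
    by (auto simp: positives_def strictly_less_def)
qed

lemma C_ordering_cone_order:
  assumes P: "conrad_cone G (carrier G) P"
  shows "C_ordering G (cone_order P)" "positives (cone_order P) = P"
proof -
  interpret conrad_group G "carrier G" P using conrad_groupI[OF subgroup_self P] .
  have mem: "(x, y) \<in> cone_order P \<longleftrightarrow> x = y \<or> lt x y" if "x \<in> carrier G" "y \<in> carrier G" for x y
    using that unfolding cone_order_def lt_def by simp
  have lo: "left_ordering G (cone_order P)"
    unfolding left_ordering_def
  proof (intro conjI ballI impI)
    show "cone_order P \<subseteq> carrier G \<times> carrier G" unfolding cone_order_def by auto
  next
    fix x y assume "x \<in> carrier G" "y \<in> carrier G" "(x, y) \<in> cone_order P \<and> (y, x) \<in> cone_order P"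
    thus "x = y" using mem lt_asym by blast
  next
    fix x y z assume c: "x \<in> carrier G" "y \<in> carrier G" "z \<in> carrier G"
      and "(x, y) \<in> cone_order P \<and> (y, z) \<in> cone_order P"
    thus "(x, z) \<in> cone_order P" using mem[of x y] mem[of y z] mem[of x z] lt_trans[of x y z] by auto
  next
    fix x y assume "x \<in> carrier G" "y \<in> carrier G"
    thus "(x, y) \<in> cone_order P \<or> (y, x) \<in> cone_order P" using mem lt_total by blast
  qed (auto simp: mem)
  show pos: "positives (cone_order P) = P"
    unfolding positives_def strictly_less_def using mem[OF one_closed] lt_one by auto
  have "\<exists>n::nat. n \<ge> 1 \<and> strictly_less (cone_order P) g (f \<otimes> g [^] n)"
    if fg: "f \<in> carrier G" "g \<in> carrier G" "strictly_less (cone_order P) \<one> f \<and> strictly_less (cone_order P) \<one> g"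
    for f g
  proof -
    have fgP: "f \<in> P" "g \<in> P" using fg pos unfolding positives_def by auto
    have eq: "f \<otimes> g [^] (2::nat) = f \<otimes> g \<otimes> g" using fg by (simp add: numeral_2_eq_2 m_assoc)
    \<comment> \<open>The exponent 2 satisfies n >= 1, whereas the exponent supplied by the cone
      condition might be 0.\<close>
    have "lt g (f \<otimes> g [^] (2::nat))" unfolding eq using conrad_two[OF fgP] .
    hence "strictly_less (cone_order P) g (f \<otimes> g [^] (2::nat))"
      using strictly_less_iff_positive[OF lo] fg unfolding pos lt_def by simp
    moreover have "(2::nat) \<ge> 1" by simp
    ultimately show ?thesis by blast
  qed
  thus "C_ordering G (cone_order P)" unfolding C_ordering_def using lo by blast
qed

lemma bij_betw_positives:
  "bij_betw positives {R. C_ordering G R} {P. conrad_cone G (carrier G) P}"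
proof (rule bij_betw_byWitness[where f' = cone_order])
  show "\<forall>P\<in>{P. conrad_cone G (carrier G) P}. positives (cone_order P) = P"
    using C_ordering_cone_order(2) by blast
  show "\<forall>R\<in>{R. C_ordering G R}. cone_order (positives R) = R"
  proof
    fix R assume "R \<in> {R. C_ordering G R}"
    hence R: "left_ordering G R" unfolding C_ordering_def by simp
    hence sub: "R \<subseteq> carrier G \<times> carrier G" and refl: "\<And>x. x \<in> carrier G \<Longrightarrow> (x, x) \<in> R"
      unfolding left_ordering_def by auto
    have "(x, y) \<in> cone_order (positives R) \<longleftrightarrow> (x, y) \<in> R" for x y
    proof (cases "x \<in> carrier G \<and> y \<in> carrier G")
      case True
      thus ?thesis using strictly_less_iff_positive[OF R, of x y] refl[of x]
        unfolding cone_order_def strictly_less_def by auto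
    next
      case False
      thus ?thesis using sub unfolding cone_order_def by auto
    qed
    thus "cone_order (positives R) = R" by auto
  qed
qed (use conrad_cone_positives C_ordering_cone_order(1) in auto)

lemma rational_series_iff: "rational_series G S n \<longleftrightarrow> rational_chain G S n \<and> S n = carrier G"
  unfolding rational_series_def rational_chain_def by blast

text \<open>Normality in \<open>G\<close> restricts to normality in \<open>S (i + 2)\<close>, which
  is the extra clause of \<open>nonabelian_chain\<close>.\<close>

lemma nonabelian_chain_iff:
  assumes "normal_rational_series G S n"
  shows "nonabelian_chain G S n \<longleftrightarrow> no_abelian_two_step G S n"
proof -
  have chain: "rational_chain G S n" "\<And>i. i \<le> n \<Longrightarrow> S i \<lhd> G"
    using assms unfolding normal_rational_series_def rational_series_iff by auto
  have "S i \<lhd> G\<lparr>carrier := S (i + 2)\<rparr>" if i: "i + 2 \<le> n" for i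
  proof (rule normal_restrict_supergroup)
    show "subgroup (S (i + 2)) G" using rational_chainD(2)[OF chain(1) i] .
    show "S i \<lhd> G" using chain(2) i by simp
    show "S i \<subseteq> S (i + 2)"
      using rational_chainD(5)[OF chain(1), of i] rational_chainD(5)[OF chain(1), of "Suc i"] i by auto
  qed
  thus ?thesis using chain(1) unfolding nonabelian_chain_def no_abelian_two_step_def by blast
qed

end

theorem theoremB:
  fixes G :: "('a, 'b) monoid_scheme"
  assumes "group G"
  shows "(C_orderable G \<and> finite {R. C_ordering G R} \<longrightarrow>
            (\<exists>n S. rational_series G S n \<and>
                   (\<forall>m T. rational_series G T m \<longrightarrow> m = n \<and> (\<forall>i\<le>n. T i = S i)) \<and>
                   normal_rational_series G S n \<and>
                   no_abelian_two_step G S n))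
       \<and> (\<forall>S n. normal_rational_series G S n \<and> no_abelian_two_step G S n \<longrightarrow>
            card {R. C_ordering G R} = 2 ^ n)"
proof (intro conjI allI impI)
  interpret group G by fact
  assume "C_orderable G \<and> finite {R. C_ordering G R}"
  then obtain R where R: "C_ordering G R" and "finite {R. C_ordering G R}"
    unfolding C_orderable_def by blast
  hence "finite {P. conrad_cone G (carrier G) P}" using bij_betw_finite[OF bij_betw_positives] by blast
  from finite_cones_chain[OF subgroup_self conrad_cone_positives[OF R] this]
  obtain n S where S: "nonabelian_chain G S n" "S n = carrier G" by blast
  have rs: "rational_series G S n" using S unfolding rational_series_iff nonabelian_chain_def by blast
  \<comment> \<open>The whole group is normal in itself, so with \<open>H\<close> equal to the
    carrier the invariance under conjugation becomes normality of every term in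
    \<open>G\<close>.\<close>
  have top: "normal_pair G (S n) (carrier G)" unfolding S(2) by (rule normal_pairI[OF subgroup_self subgroup_self]) auto
  hence "S i \<lhd> G" if "i \<le> n" for i
    using normal_pair.normal_C[OF nonabelian_chain_normal[OF S(1) top that]] by simp
  hence nrs: "normal_rational_series G S n" using rs unfolding normal_rational_series_def by blast
  have "m = n \<and> (\<forall>i\<le>n. T i = S i)" if "rational_series G T m" for m T
    using nonabelian_chain_unique[OF S(1), of T m] S(2) that unfolding rational_series_iff by simp
  thus "\<exists>n S. rational_series G S n \<and>
                   (\<forall>m T. rational_series G T m \<longrightarrow> m = n \<and> (\<forall>i\<le>n. T i = S i)) \<and>
                   normal_rational_series G S n \<and>
                   no_abelian_two_step G S n"
    using rs nrs nonabelian_chain_iff[OF nrs] S(1) by blast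
next
  interpret group G by fact
  fix S n assume S: "normal_rational_series G S n \<and> no_abelian_two_step G S n"
  hence chain: "nonabelian_chain G S n" and top: "S n = carrier G"
    using nonabelian_chain_iff unfolding normal_rational_series_def rational_series_iff by blast+
  have "card {R. C_ordering G R} = card {P. conrad_cone G (carrier G) P}"
    using bij_betw_same_card[OF bij_betw_positives] .
  thus "card {R. C_ordering G R} = 2 ^ n" using card_conrad_cones[OF chain] unfolding top by simp
qed

end
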